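(* Let $k<n$ be positive integers, $J=\{1,\dots,n\}$, and let integers $b^i_j$ ($j\in J$, $1\le i\le k$), nonzero integers $a_1,\dots,a_n$, an integer $\kappa$ and a prime $p$ be given as in the context, with $p$ good and $p\nmid\kappa$. Let $A=(A_1,\dots,A_n)$ be positive integers with $[A_j]=[a_j]/[\kappa]$ in $\mathbb F_p$ for all $j\in J$. Let $q=(q_1,\dots,q_k)\in\mathbb Z^k$ and let $l_1,\dots,l_k$ be positive integers. For each independent $\{j_1<\dots<j_k\}\subset J$ consider the polynomial $$X_{j_1,\dots,j_k}(z,t,A)=\Big(\prod_{j\in J}f_j(z,t)^{A_j}\Big)\frac{d_{j_1,\dots,j_k}}{\prod_{l=1}^k f_{j_l}(z,t)}\in\mathbb Z[z_1,\dots,z_n,t_1,\dots,t_k]$$ and its Taylor expansion $X_{j_1,\dots,j_k}(z,t,A)=\sum_{i_1,\dots,i_k\ge0}I^{i_1,\dots,i_k}_{j_1,\dots,j_k}(z,q,A)(t_1-q_1)^{i_1}\cdots(t_k-q_k)^{i_k}$ with $I^{i_1,\dots,i_k}_{j_1,\dots,j_k}(z,q,A)\in\mathbb Z[z_1,\dots,z_n]$. Let $[I]^{i_1,\dots,i_k}_{j_1,\dots,j_k}(z,q,A)\in\mathbb F_p[z_1,\dots,z_n]$ denote the coefficientwise reduction mod $p$, and set $$I(z)=\sum_{\text{independent }\{j_1<\dots<j_k\}}[I]^{l_1p-1,\dots,l_kp-1}_{j_1,\dots,j_k}(z,q,A)\,F(j_1,\dots,j_k)\in V\otimes\mathbb F_p[z_1,\dots,z_n].$$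 Then $I(z)$ satisfies the singular vector equations (with respect to the weights $a$) identically in $z$, and it satisfies the Gauss–Manin differential equations over $\mathbb F_p$: $$[\kappa]\frac{\partial I}{\partial z_i}(z)=[K]_i(z)\,I(z),\qquad i\in J.$$
   Context: Setting. Let $k<n$ be positive integers and $J=\{1,\dots,n\}$. Fix integers $b^i_j$ ($j\in J$, $i=1,\dots,k$) such that each linear form $g_j(t)=\sum_{i=1}^k b^i_jt_i$ is nonzero and $g_1,\dots,g_n$ span a $k$-dimensional space. Put $f_j(z,t)=z_j+g_j(t)$, a polynomial in $z=(z_1,\dots,z_n)$, $t=(t_1,\dots,t_k)$. A circuit is a subset $C\subset J$ such that $(g_i)_{i\in C}$ are linearly dependent over $\mathbb C$ but every proper subset of $C$ gives linearly independent forms; $\mathfrak C$ denotes the set of circuits. For each circuit $C$ fix integers $(\lambda^i_C)_{i\in J}$, not all zero, with $\lambda^i_C=0$ for $i\notin C$, $\sum_{i\in J}\lambda^i_Cg_i=0$ and $\gcd_i(\lambda^i_C)=1$, and put $f_C(z)=\sum_{i\in J}\lambda^i_Cz_i$. For a prime $p$, $[\cdot]:\mathbb Z\to\mathbb F_p$ is reduction mod $p$, applied coefficientwise to polynomials; $[g]_j$, $[f]_j=z_j+[g]_j$, $[f]_C$ are the reductions. The prime $p$ is called good if all $[g]_j$, $[f]_j$ ($j\in J$) and $[f]_C$ ($C\in\mathfrak C$) are nonzero and the circuits of $([g]_j)_{j\in J}$ over $\mathbb F_p$ (minimal $\mathbb F_p$-linearly dependent subsets) are exactly the elements of $\mathfrak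 C$. A $k$-element subset $\{j_1,\dots,j_k\}\subset J$ is independent if $g_{j_1},\dots,g_{j_k}$ are linearly independent. Put $d_{j_1,\dots,j_k}=\det_{i,l=1}^k(b^i_{j_l})$. The space $V$: the $\mathbb F_p$-vector space with basis $F(j_1,\dots,j_k)$ indexed by independent subsets $\{j_1<\dots<j_k\}$; for any permutation $\sigma$ set $F(j_{\sigma(1)},\dots,j_{\sigma(k)})=\mathrm{sgn}(\sigma)F(j_1,\dots,j_k)$. Singular vector equations: for $v=\sum I_{j_1,\dots,j_k}F(j_1,\dots,j_k)$ (sum over independent increasing tuples), extend the coefficients to all $(j_1,\dots,j_k)\in J^k$ by skew-symmetry in the indices and by $I_{j_1,\dots,j_k}=0$ if the entries are not distinct or do not form an independent set. Then $v$ satisfies the singular vector equations if $\sum_{j\in J}[a_j]I_{j,j_2,\dots,j_k}=0$ for all $j_2,\dots,j_k\in J$. Operators $[L]_C$: for a circuit $C=\{i_1<\dots<i_r\}$ and $C_m=C\setminus\{i_m\}$, define $[L]_C$ on basis vectors: $[L]_CF(j_1,\dots,j_k)=0$ if $|\{j_1,\dots,j_k\}\cap C|<r-1$; if $\{j_1,\dots,j_k\}\cap C=C_m$, write $\{j_1,\dots,j_k\}\setminus C_m=\{s_1,\dots,s_{k-r+1}\}$ and set (extending linearly using the sign rule) $$[L]_C F(i_1,\dots,\widehat{i_m},\dots,i_r,s_1,\dots,s_{k-r+1})=(-1)^m\sum_{l=1}^r(-1)^l[a_{i_l}]F(i_1,\dots,\widehat{i_l},\dots,i_r,s_1,\dots,s_{k-r+1}).$$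 Geometric Hamiltonians: $[K]_i(z)=\sum_{C\in\mathfrak C}\frac{[\lambda^i_C]}{[f]_C(z)}[L]_C$, $i\in J$, rational functions in $z$ with values in $\mathrm{End}(V)$. Derivatives in $z$ are formal. *)

theory Defs
  imports Complex_Main "HOL-Library.Poly_Mapping" "HOL-Computational_Algebra.Fraction_Field"
    "HOL-Combinatorics.Permutations" "HOL-Computational_Algebra.Primes"
begin

text \<open>Multivariate polynomials in variables indexed by nat (variable j is z_j, resp. s_i).\<close>
type_synonym 'a mpoly = "(nat \<Rightarrow>\<^sub>0 nat) \<Rightarrow>\<^sub>0 'a"

definition Var :: "nat \<Rightarrow> 'a::{zero,one} mpoly" where
  "Var j = Poly_Mapping.single (Poly_Mapping.single j 1) 1"

definition Const :: "'a::zero \<Rightarrow> 'a mpoly" where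
  "Const c = Poly_Mapping.single 0 c"

definition pdz :: "nat \<Rightarrow> 'a::semiring_1 mpoly \<Rightarrow> 'a mpoly" where
  "pdz j P = Abs_poly_mapping
     (\<lambda>m::nat \<Rightarrow>\<^sub>0 nat. of_nat (Poly_Mapping.lookup m j + 1) * Poly_Mapping.lookup P (m + Poly_Mapping.single j 1))"

text \<open>Linear dependence of the forms g_j = sum_i b i j t_i, j in C, over a field,
  the integer coefficients being mapped into the field by phi.\<close>
definition lin_dep :: "(int \<Rightarrow> 'f::field) \<Rightarrow> nat \<Rightarrow> (nat \<Rightarrow> nat \<Rightarrow> int) \<Rightarrow> nat set \<Rightarrow> bool" where
  "lin_dep \<phi> k b C \<longleftrightarrow>
     (\<exists>c::nat \<Rightarrow> 'f. (\<exists>j\<in>C. c j \<noteq> 0) \<and> (\<forall>i\<in>{1..k}. (\<Sum>j\<in>C. c j * \<phi> (b i j)) = 0))"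

definition is_circuit :: "(int \<Rightarrow> 'f::field) \<Rightarrow> nat \<Rightarrow> (nat \<Rightarrow> nat \<Rightarrow> int) \<Rightarrow> nat set \<Rightarrow> bool" where
  "is_circuit \<phi> k b C \<longleftrightarrow> lin_dep \<phi> k b C \<and> (\<forall>D. D \<subset> C \<longrightarrow> \<not> lin_dep \<phi> k b D)"

definition circuits :: "(int \<Rightarrow> 'f::field) \<Rightarrow> nat \<Rightarrow> nat \<Rightarrow> (nat \<Rightarrow> nat \<Rightarrow> int) \<Rightarrow> nat set set" where
  "circuits \<phi> n k b = {C. C \<subseteq> {1..n} \<and> is_circuit \<phi> k b C}"

definition indep_sets :: "nat \<Rightarrow> nat \<Rightarrow> (nat \<Rightarrow> nat \<Rightarrow> int) \<Rightarrow> nat set set" where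
  "indep_sets n k b = {S. S \<subseteq> {1..n} \<and> card S = k \<and> \<not> lin_dep (of_int :: int \<Rightarrow> complex) k b S}"

text \<open>d_{j_1..j_k} = det (b^i_{j_l}), j_1 < ... < j_k the elements of S (Leibniz formula).\<close>
definition dval :: "nat \<Rightarrow> (nat \<Rightarrow> nat \<Rightarrow> int) \<Rightarrow> nat set \<Rightarrow> int" where
  "dval k b S = (let js = sorted_list_of_set S in
     (\<Sum>\<sigma> | \<sigma> permutes {1..k}. sign \<sigma> * (\<Prod>i\<in>{1..k}. b i (js ! (\<sigma> i - 1)))))"

text \<open>f_j(z, q + s) as a polynomial in z with coefficients in Z[s]: variable j of the outer
  ring is z_j, variable i of the inner ring is s_i = t_i - q_i.\<close>
definition fzs :: "nat \<Rightarrow> (nat \<Rightarrow> nat \<Rightarrow> int) \<Rightarrow> (nat \<Rightarrow> int) \<Rightarrow> nat \<Rightarrow> int mpoly mpoly" where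
  "fzs k b q j = Var j + Const (Const (\<Sum>i\<in>{1..k}. b i j * q i) + (\<Sum>i\<in>{1..k}. Const (b i j) * Var i))"

text \<open>X_S(z, q + s, A) = d_S * prod_j f_j^{A_j} / prod_{j in S} f_j (the division is exact).\<close>
definition Xpoly :: "nat \<Rightarrow> nat \<Rightarrow> (nat \<Rightarrow> nat \<Rightarrow> int) \<Rightarrow> (nat \<Rightarrow> int) \<Rightarrow> (nat \<Rightarrow> nat) \<Rightarrow> nat set
    \<Rightarrow> int mpoly mpoly" where
  "Xpoly n k b q A S = Const (Const (dval k b S)) *
     (\<Prod>j\<in>{1..n}. fzs k b q j ^ (A j - (if j \<in> S then 1 else 0)))"

text \<open>Reduction mod p of the Taylor coefficient of (t - q)^e, as a polynomial in z.\<close>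
definition Icoef :: "nat \<Rightarrow> nat \<Rightarrow> (nat \<Rightarrow> nat \<Rightarrow> int) \<Rightarrow> (nat \<Rightarrow> int) \<Rightarrow> (nat \<Rightarrow> nat)
    \<Rightarrow> (nat \<Rightarrow>\<^sub>0 nat) \<Rightarrow> nat set \<Rightarrow> 'f::ring_1 mpoly" where
  "Icoef n k b q A e S = Poly_Mapping.map (\<lambda>c. of_int (Poly_Mapping.lookup c e)) (Xpoly n k b q A S)"

text \<open>Vectors of V (tensor a coefficient ring) are represented as functions from subsets
  S to the coefficient of F(j_1,...,j_k), j_1<...<j_k the elements of S.\<close>

definition lsign :: "nat list \<Rightarrow> 'a::ring_1" where
  "lsign xs = (-1) ^ card {(x, y). x < y \<and> y < length xs \<and> xs ! y < xs ! x}"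

definition Fvec :: "nat list \<Rightarrow> nat set \<Rightarrow> 'a::ring_1" where
  "Fvec xs = (\<lambda>T. if distinct xs \<and> T = set xs then lsign xs else 0)"

definition Iext :: "nat \<Rightarrow> nat \<Rightarrow> (nat \<Rightarrow> nat \<Rightarrow> int) \<Rightarrow> (nat set \<Rightarrow> 'a::ring_1) \<Rightarrow> nat list \<Rightarrow> 'a" where
  "Iext n k b v js = (if distinct js \<and> set js \<in> indep_sets n k b then lsign js * v (set js) else 0)"

definition singular_eqs :: "nat \<Rightarrow> nat \<Rightarrow> (nat \<Rightarrow> nat \<Rightarrow> int) \<Rightarrow> (nat \<Rightarrow> int)
    \<Rightarrow> (nat set \<Rightarrow> 'a::ring_1) \<Rightarrow> bool" where
  "singular_eqs n k b a v \<longleftrightarrow>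
     (\<forall>js. length js = k - 1 \<and> set js \<subseteq> {1..n} \<longrightarrow>
        (\<Sum>j\<in>{1..n}. of_int (a j) * Iext n k b v (j # js)) = 0)"

definition Lbasis :: "(nat \<Rightarrow> int) \<Rightarrow> nat set \<Rightarrow> nat set \<Rightarrow> nat set \<Rightarrow> 'a::ring_1" where
  "Lbasis a C S = (let cs = sorted_list_of_set C; r = length cs;
       ss = sorted_list_of_set (S - C); wo = (\<lambda>i. take i cs @ drop (Suc i) cs) in
     if (\<exists>m<r. S \<inter> C = C - {cs ! m}) then
       (let m = (THE m. m < r \<and> S \<inter> C = C - {cs ! m}) in
        (\<lambda>T. \<Sum>l<r. lsign (wo m @ ss) * (-1) ^ (m + l) * of_int (a (cs ! l)) * Fvec (wo l @ ss) T))
     else (\<lambda>T. 0))"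

definition Lop :: "nat \<Rightarrow> nat \<Rightarrow> (nat \<Rightarrow> nat \<Rightarrow> int) \<Rightarrow> (nat \<Rightarrow> int) \<Rightarrow> nat set
    \<Rightarrow> (nat set \<Rightarrow> 'a::ring_1) \<Rightarrow> nat set \<Rightarrow> 'a" where
  "Lop n k b a C v = (\<lambda>T. \<Sum>S\<in>indep_sets n k b. v S * Lbasis a C S T)"

definition fC :: "nat \<Rightarrow> (nat \<Rightarrow> int) \<Rightarrow> 'f::ring_1 mpoly" where
  "fC n lam = (\<Sum>i\<in>{1..n}. Const (of_int (lam i)) * Var i)"

end

theory Submission
  imports Defs
begin

text \<open>
Write $y(m)$ for the reduced Taylor coefficient, at the exponent $(l_1p-1,\dots,l_kp-1)$, of
$\prod_j f_j^{m_j}$. Three identities hold: $\partial_{z_i} y(m) = m_i\, y(m-1_i)$; the total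
derivatives vanish, $\sum_j m_j b^i_j\, y(m-1_j) = 0$, because $l_ip = 0$ in the field; and
$\sum_j \lambda_j\, y(m+1_j) = f_C\, y(m)$ for a linear relation $\lambda$ among the $g_j$.
The coordinates of $I$ are $I_S = d_S\, y(A - 1_S)$. Contracting the second identity with cofactors
gives the singular vector equations. By Cramer's rule and the third identity, $\lambda_C^c L_C I$ has
coordinate $a_c\, d_T\, f_C\, y(A-1_{T\cup c})$ at $T$ if $C \setminus T = \{c\}$ and $0$ otherwise.
So $f_C$ cancels in $K_i I$, the circuits that contribute at $T$ are the fundamental circuits of the
$j \notin T$, and the second identity, contracted with the cofactors of the column $i$ in $T$,
gives the Gauss--Manin equations.
\<close>


text \<open>Two difficulties shape the proof: signs and division. Signs: F is alternating, and L_C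
  is defined through sorted lists with one entry omitted. Passing from d_S on sorted sets to the
  determinant of an arbitrary list absorbs every sign: the sign of the list xs times the coordinate
  of I at its set is Det(xs) y(A - 1_xs). What remains is Cramer's rule for lists. The minors are
  kept in Z, so that d = -d forces d = 0 and the conclusion survives reduction modulo 2. Division:
  lambda_C^c is invertible in the field because goodness makes C a circuit over that field, and a
  nontrivial relation on a circuit has no zero coefficient. The factor f_C is exhibited by a
  polynomial identity for lambda_C^c L_C I, so that fractions enter only at the very end.
  Fundamental circuits require T to be a basis over the field, that is d_T nonzero there; where d_T
  = 0 both sides vanish at T. Exponents are natural numbers with truncated subtraction: m_j - 1
  always comes with a factor m_j, and exponents are restored by adding 1 because A_j > 0.\<close>

section \<open>Induction and coefficientwise maps for polynomials\<close>

lemma poly_mapping_add_induct [case_names single add]: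
  fixes P :: "('a \<Rightarrow>\<^sub>0 'b::comm_monoid_add) \<Rightarrow> bool"
  assumes single: "\<And>m c. P (Poly_Mapping.single m c)"
    and add: "\<And>x y. P x \<Longrightarrow> P y \<Longrightarrow> P (x + y)"
  shows "P x"
proof (induction x rule: update_induct)
  case const
  have "P (Poly_Mapping.single undefined 0)" by (rule single)
  then show ?case by simp
next
  case (update f m c)
  have "Poly_Mapping.update m c f = f + Poly_Mapping.single m c"
    using update.hyps
    by (intro poly_mapping_eqI) (auto simp: lookup_update lookup_add lookup_single in_keys_iff)
  then show ?case using add[OF update.IH single] by simp
qed

lemma lookup_map_zero:
  "f 0 = 0 \<Longrightarrow> Poly_Mapping.lookup (Poly_Mapping.map f P) m = f (Poly_Mapping.lookup P m)"
  by (simp add: Poly_Mapping.map.rep_eq when_def)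

lemma map_add_of_additive:
  assumes "\<And>x y. f (x + y) = f x + f y" "f 0 = 0"
  shows "Poly_Mapping.map f (P + Q) = Poly_Mapping.map f P + Poly_Mapping.map f Q"
  by (intro poly_mapping_eqI) (simp add: lookup_map_zero assms lookup_add)

lemma map_single_zero:
  "f 0 = 0 \<Longrightarrow> Poly_Mapping.map f (Poly_Mapping.single m c) = Poly_Mapping.single m (f c)"
  by (intro poly_mapping_eqI) (simp add: lookup_map_zero lookup_single when_def)

subsection \<open>Derivations\<close>

text \<open>One notion for both derivatives on Z[s][z]: \<open>pdz i\<close> in z_i, and
  \<open>Poly_Mapping.map (pdz i)\<close>, which is the derivative in s_i acting on coefficients.
  The product rule for powers is then proved once.\<close>

definition derivation :: "('a::comm_ring_1 \<Rightarrow> 'a) \<Rightarrow> bool" where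
  "derivation D \<longleftrightarrow> (\<forall>x y. D (x + y) = D x + D y) \<and> (\<forall>x y. D (x * y) = D x * y + x * D y)"

lemma derivationD:
  assumes "derivation D"
  shows "D (x + y) = D x + D y" "D (x * y) = D x * y + x * D y"
  using assms by (auto simp: derivation_def)

lemma derivation_zero_one:
  assumes "derivation D"
  shows "D 0 = 0" "D 1 = 0"
  using derivationD(1)[OF assms, of 0 0] derivationD(2)[OF assms, of 1 1] by simp_all

lemma derivation_power:
  assumes "derivation D"
  shows "D (f ^ m) = of_nat m * D f * f ^ (m - 1)"
proof (induction m)
  case 0
  then show ?case using derivation_zero_one[OF assms] by simp
next
  case (Suc m)
  then show ?case
    by (cases m) (simp_all add: derivationD[OF assms] derivation_zero_one[OF assms] algebra_simps)
qed

text \<open>Lowering the exponent inside the full product replaces division by \<open>f j\<close>.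
  The truncation at \<open>m j = 0\<close> is harmless, since the factor \<open>of_nat (m j)\<close>
  kills that term.\<close>

lemma derivation_prod_power:
  assumes D: "derivation D" and "finite J"
  shows "D (\<Prod>j\<in>J. f j ^ m j) =
    (\<Sum>j\<in>J. of_nat (m j) * D (f j) * (\<Prod>i\<in>J. f i ^ (m i - (if i = j then 1 else 0))))"
  using \<open>finite J\<close>
proof (induction J rule: finite_induct)
  case empty
  then show ?case using derivation_zero_one[OF D] by simp
next
  case (insert x J)
  have "D (\<Prod>j\<in>insert x J. f j ^ m j) =
      of_nat (m x) * D (f x) * f x ^ (m x - 1) * (\<Prod>j\<in>J. f j ^ m j) + f x ^ m x *
       (\<Sum>j\<in>J. of_nat (m j) * D (f j) * (\<Prod>i\<in>J. f i ^ (m i - (if i = j then 1 else 0))))"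
    using insert by (simp add: derivationD[OF D] derivation_power[OF D])
  also have "(\<Prod>j\<in>J. f j ^ m j) = (\<Prod>i\<in>J. f i ^ (m i - (if i = x then 1 else 0)))"
    using insert.hyps by (intro prod.cong) auto
  also have "f x ^ m x *
       (\<Sum>j\<in>J. of_nat (m j) * D (f j) * (\<Prod>i\<in>J. f i ^ (m i - (if i = j then 1 else 0)))) =
      (\<Sum>j\<in>J. of_nat (m j) * D (f j) * (\<Prod>i\<in>insert x J. f i ^ (m i - (if i = j then 1 else 0))))"
    unfolding sum_distrib_left
  proof (rule sum.cong)
    fix j assume "j \<in> J"
    then have "x \<noteq> j" using insert.hyps by auto
    then show "f x ^ m x * (of_nat (m j) * D (f j) * (\<Prod>i\<in>J. f i ^ (m i - (if i = j then 1 else 0)))) =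
      of_nat (m j) * D (f j) * (\<Prod>i\<in>insert x J. f i ^ (m i - (if i = j then 1 else 0)))"
      using insert.hyps by (simp add: algebra_simps)
  qed simp
  finally show ?case using insert.hyps by (simp add: algebra_simps)
qed

lemma finite_pdz_support:
  fixes P :: "'a::semiring_1 mpoly"
  shows "finite {m. of_nat (Poly_Mapping.lookup m j + 1) *
    Poly_Mapping.lookup P (m + Poly_Mapping.single j 1) \<noteq> 0}"
proof (rule finite_subset)
  show "{m. of_nat (Poly_Mapping.lookup m j + 1) *
      Poly_Mapping.lookup P (m + Poly_Mapping.single j 1) \<noteq> 0}
    \<subseteq> (\<lambda>m. m - Poly_Mapping.single j 1) ` Poly_Mapping.keys P"
  proof
    fix m assume "m \<in> {m. of_nat (Poly_Mapping.lookup m j + 1) *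
      Poly_Mapping.lookup P (m + Poly_Mapping.single j 1) \<noteq> 0}"
    then have "m + Poly_Mapping.single j 1 \<in> Poly_Mapping.keys P"
      by (auto simp: in_keys_iff)
    then show "m \<in> (\<lambda>m. m - Poly_Mapping.single j 1) ` Poly_Mapping.keys P"
      by (rule rev_image_eqI) simp
  qed
qed simp

lemma lookup_pdz:
  "Poly_Mapping.lookup (pdz j P) m =
    of_nat (Poly_Mapping.lookup m j + 1) * Poly_Mapping.lookup P (m + Poly_Mapping.single j 1)"
  unfolding pdz_def by (subst lookup_Abs_poly_mapping) (auto intro: finite_pdz_support[simplified])

lemma pdz_add: "pdz j (P + Q) = pdz j P + pdz j Q"
  by (intro poly_mapping_eqI) (simp add: lookup_pdz lookup_add distrib_left)

lemma pdz_0 [simp]: "pdz j 0 = 0"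
  by (intro poly_mapping_eqI) (simp add: lookup_pdz)

lemma minus_single_add_single:
  fixes m :: "nat \<Rightarrow>\<^sub>0 nat"
  assumes "Poly_Mapping.lookup m j \<noteq> 0"
  shows "m - Poly_Mapping.single j 1 + Poly_Mapping.single j 1 = m"
  using assms by (intro poly_mapping_eqI) (auto simp: lookup_add lookup_minus lookup_single when_def)

lemma pdz_single:
  "pdz j (Poly_Mapping.single m c) =
    Poly_Mapping.single (m - Poly_Mapping.single j 1) (of_nat (Poly_Mapping.lookup m j) * c)"
proof (rule poly_mapping_eqI)
  fix m'
  show "Poly_Mapping.lookup (pdz j (Poly_Mapping.single m c)) m' = Poly_Mapping.lookup
    (Poly_Mapping.single (m - Poly_Mapping.single j 1) (of_nat (Poly_Mapping.lookup m j) * c)) m'"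
  proof (cases "Poly_Mapping.lookup m j = 0")
    case True
    then have "m \<noteq> m' + Poly_Mapping.single j 1" by (auto simp: lookup_add)
    then show ?thesis using True by (simp add: lookup_pdz lookup_single)
  next
    case False
    then have iff: "m = m' + Poly_Mapping.single j 1 \<longleftrightarrow> m - Poly_Mapping.single j 1 = m'"
      using minus_single_add_single by fastforce
    show ?thesis
    proof (cases "m = m' + Poly_Mapping.single j 1")
      case True
      show ?thesis unfolding True by (simp add: lookup_pdz lookup_add)
    next
      case False
      with iff show ?thesis by (auto simp: lookup_pdz lookup_single when_def)
    qed
  qed
qed

lemma pdz_mult_single:
  fixes c d :: "'a::comm_ring_1"
  shows "pdz j (Poly_Mapping.single m c * Poly_Mapping.single m' d) =
    pdz j (Poly_Mapping.single m c) * Poly_Mapping.single m' d +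
    Poly_Mapping.single m c * pdz j (Poly_Mapping.single m' d)"
proof -
  let ?e = "Poly_Mapping.single j (1::nat)"
  let ?m = "Poly_Mapping.lookup m j" and ?m' = "Poly_Mapping.lookup m' j"
  \<comment> \<open>The exponents \<open>m - ?e + m'\<close> and \<open>m + m' - ?e\<close> may
    differ when z_j does not occur in \<open>m\<close>, but then the coefficient is 0.\<close>
  have 1: "Poly_Mapping.single (m - ?e + m') (of_nat ?m * c * d) =
      Poly_Mapping.single (m + m' - ?e) (of_nat ?m * c * d)"
  proof (cases "?m = 0")
    case False
    then have "m - ?e + m' = m + m' - ?e"
      by (intro poly_mapping_eqI) (auto simp: lookup_add lookup_minus lookup_single when_def)
    then show ?thesis by simp
  qed simp
  have 2: "Poly_Mapping.single (m + (m' - ?e)) (of_nat ?m' * c * d) =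
      Poly_Mapping.single (m + m' - ?e) (of_nat ?m' * c * d)"
  proof (cases "?m' = 0")
    case False
    then have "m + (m' - ?e) = m + m' - ?e"
      by (intro poly_mapping_eqI) (auto simp: lookup_add lookup_minus lookup_single when_def)
    then show ?thesis by simp
  qed simp
  have "pdz j (Poly_Mapping.single m c * Poly_Mapping.single m' d) =
    Poly_Mapping.single (m + m' - ?e) (of_nat ?m * c * d) +
    Poly_Mapping.single (m + m' - ?e) (of_nat ?m' * c * d)"
    by (simp add: mult_single pdz_single lookup_add algebra_simps flip: single_add)
  also have "\<dots> = Poly_Mapping.single (m - ?e + m') (of_nat ?m * c * d) +
      Poly_Mapping.single (m + (m' - ?e)) (of_nat ?m' * c * d)"
    by (simp only: 1 2)
  finally show ?thesis by (simp add: mult_single pdz_single algebra_simps)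
qed

text \<open>Both sides of the Leibniz rule are biadditive, so monomials suffice.\<close>

lemma derivation_poly_mappingI:
  fixes D :: "('a::comm_monoid_add \<Rightarrow>\<^sub>0 'b::comm_ring_1) \<Rightarrow> ('a \<Rightarrow>\<^sub>0 'b)"
  assumes add: "\<And>x y. D (x + y) = D x + D y"
    and single: "\<And>m c m' c'. D (Poly_Mapping.single m c * Poly_Mapping.single m' c') =
      D (Poly_Mapping.single m c) * Poly_Mapping.single m' c' +
      Poly_Mapping.single m c * D (Poly_Mapping.single m' c')"
  shows "derivation D"
proof -
  have "D (x * y) = D x * y + x * D y" for x y
  proof (induction x rule: poly_mapping_add_induct)
    case (single m c)
    show ?case
    proof (induction y rule: poly_mapping_add_induct)
      case (single m' c')
      show ?case by (rule assms(2))
    next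
      case (add y z)
      then show ?case by (simp add: assms(1) algebra_simps)
    qed
  next
    case (add x z)
    then show ?case by (simp add: assms(1) algebra_simps)
  qed
  with add show ?thesis by (simp add: derivation_def)
qed

lemma derivation_pdz: "derivation (pdz j :: 'a::comm_ring_1 mpoly \<Rightarrow> 'a mpoly)"
  by (intro derivation_poly_mappingI pdz_add pdz_mult_single)

lemma derivation_map:
  fixes D :: "'b::comm_ring_1 \<Rightarrow> 'b"
  assumes D: "derivation D"
  shows "derivation (Poly_Mapping.map D :: ('a::comm_monoid_add \<Rightarrow>\<^sub>0 'b) \<Rightarrow> _)"
proof (rule derivation_poly_mappingI)
  show "Poly_Mapping.map D (x + y) = Poly_Mapping.map D x + Poly_Mapping.map D y"
    for x y :: "'a \<Rightarrow>\<^sub>0 'b"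
    by (intro map_add_of_additive derivationD[OF D] derivation_zero_one[OF D])
  show "Poly_Mapping.map D (Poly_Mapping.single m c * Poly_Mapping.single m' c') =
      Poly_Mapping.map D (Poly_Mapping.single m c) * Poly_Mapping.single m' c' +
      Poly_Mapping.single m c * Poly_Mapping.map D (Poly_Mapping.single m' c')"
    for m m' :: 'a and c c'
    using derivation_zero_one[OF D]
    by (simp add: mult_single map_single_zero derivationD[OF D] flip: single_add)
qed

section \<open>Constants, variables and their derivatives\<close>

lemma lookup_Const_mult: "Poly_Mapping.lookup (Const c * P) m = c * Poly_Mapping.lookup P m"
  by (simp add: Const_def lookup_map_zero flip: mult_map_scale_conv_mult)

lemma Const_0 [simp]: "Const 0 = 0"
  by (simp add: Const_def)

lemma Const_add: "Const (c + d) = Const c + Const d"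
  by (simp add: Const_def single_add)

lemma Const_mult: "Const (c * d) = Const c * Const d"
  by (simp add: Const_def mult_single)

lemma Const_uminus: "Const (- c) = - Const (c::'a::ring_1)"
  by (metis Const_0 Const_add add.right_inverse minus_unique)

lemma Const_sum: "Const (sum f X) = (\<Sum>x\<in>X. Const (f x))"
  by (induction X rule: infinite_finite_induct) (simp_all add: Const_add)

lemma Const_eq_0_iff [simp]: "Const c = 0 \<longleftrightarrow> c = 0"
  by (metis Const_0 Const_def lookup_single_eq lookup_zero)

lemma Const_of_int: "Const (of_int c) = (of_int c :: 'a::ring_1 mpoly)"
  by (simp add: Const_def)

lemma Const_of_nat: "Const (of_nat c) = (of_nat c :: 'a::semiring_1 mpoly)"
  by (simp add: Const_def)

lemma pdz_Const [simp]: "pdz i (Const c) = 0"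
  by (simp add: Const_def pdz_single)

lemma pdz_Var: "pdz i (Var j) = (if i = j then 1 else 0)"
  by (auto simp: Var_def pdz_single lookup_single)

lemma pdz_Const_mult: "pdz i (Const c * P) = Const c * pdz i (P::'a::comm_ring_1 mpoly)"
  by (simp add: derivationD[OF derivation_pdz])

lemma pdz_sum: "pdz i (sum f X) = (\<Sum>x\<in>X. pdz i (f x))"
  by (induction X rule: infinite_finite_induct) (simp_all add: pdz_add)

section \<open>Reduced Taylor coefficients of products of powers of the f_j\<close>

definition Ymon :: "nat \<Rightarrow> nat \<Rightarrow> (nat \<Rightarrow> nat \<Rightarrow> int) \<Rightarrow> (nat \<Rightarrow> int) \<Rightarrow> (nat \<Rightarrow> nat)
    \<Rightarrow> int mpoly mpoly" where
  "Ymon n k b q m = (\<Prod>j\<in>{1..n}. fzs k b q j ^ m j)"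

text \<open>Extracting one coefficient in s is not multiplicative. What survives is additivity and
  linearity over integers and over the z_j, together with commutation with the z-derivatives; the
  lemmas below record exactly these.\<close>

definition taylor_coef :: "(nat \<Rightarrow>\<^sub>0 nat) \<Rightarrow> int mpoly mpoly \<Rightarrow> 'f::ring_1 mpoly" where
  "taylor_coef e P = Poly_Mapping.map (\<lambda>c. of_int (Poly_Mapping.lookup c e)) P"

definition ycoef :: "nat \<Rightarrow> nat \<Rightarrow> (nat \<Rightarrow> nat \<Rightarrow> int) \<Rightarrow> (nat \<Rightarrow> int) \<Rightarrow> (nat \<Rightarrow>\<^sub>0 nat)
    \<Rightarrow> (nat \<Rightarrow> nat) \<Rightarrow> 'f::ring_1 mpoly" where
  "ycoef n k b q e m = taylor_coef e (Ymon n k b q m)"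

lemma lookup_taylor_coef:
  "Poly_Mapping.lookup (taylor_coef e P) m = of_int (Poly_Mapping.lookup (Poly_Mapping.lookup P m) e)"
  by (simp add: taylor_coef_def lookup_map_zero)

lemma taylor_coef_add: "taylor_coef e (P + Q) = taylor_coef e P + taylor_coef e Q"
  by (intro poly_mapping_eqI) (simp add: lookup_taylor_coef lookup_add)

lemma taylor_coef_0 [simp]: "taylor_coef e 0 = 0"
  by (intro poly_mapping_eqI) (simp add: lookup_taylor_coef)

lemma taylor_coef_sum: "taylor_coef e (sum f X) = (\<Sum>x\<in>X. taylor_coef e (f x))"
  by (induction X rule: infinite_finite_induct) (simp_all add: taylor_coef_add)

lemma taylor_coef_Const_mult:
  "taylor_coef e (Const (Const c) * P) = Const (of_int c) * (taylor_coef e P :: 'f::ring_1 mpoly)"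
  by (intro poly_mapping_eqI) (simp add: lookup_taylor_coef lookup_Const_mult)

lemma taylor_coef_Var_mult:
  "taylor_coef e (Var j * P) = Var j * (taylor_coef e P :: 'f::comm_ring_1 mpoly)"
proof (induction P rule: poly_mapping_add_induct)
  case (single m c)
  have *: "taylor_coef e (Poly_Mapping.single m' c) =
      (Poly_Mapping.single m' (of_int (Poly_Mapping.lookup c e)) :: 'f mpoly)" for m'
    by (simp add: taylor_coef_def map_single_zero)
  show ?case by (simp add: Var_def mult_single *)
next
  case (add P Q)
  then show ?case by (simp add: taylor_coef_add distrib_left)
qed

lemma taylor_coef_pdz: "pdz i (taylor_coef e P) = (taylor_coef e (pdz i P) :: 'f::comm_ring_1 mpoly)"
  by (intro poly_mapping_eqI)
    (simp add: lookup_taylor_coef lookup_pdz lookup_add distrib_right lookup_Const_mult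
      flip: Const_of_nat)

text \<open>The coefficient of s^e in a derivative by s_i is (e_i + 1) times the coefficient of s^(e
  + 1_i), and e_i + 1 is a multiple of p in the application.\<close>

lemma taylor_coef_inner_derivative:
  assumes "(of_nat (Poly_Mapping.lookup e i + 1) :: 'f::comm_ring_1) = 0"
  shows "taylor_coef e (Poly_Mapping.map (pdz i) P) = (0 :: 'f mpoly)"
proof (rule poly_mapping_eqI)
  fix m
  have "Poly_Mapping.lookup (taylor_coef e (Poly_Mapping.map (pdz i) P)) m =
    (of_int (of_nat (Poly_Mapping.lookup e i + 1) * Poly_Mapping.lookup (Poly_Mapping.lookup P m)
       (e + Poly_Mapping.single i 1)) :: 'f)"
    by (simp only: lookup_taylor_coef lookup_map_zero[of "pdz i", OF pdz_0] lookup_pdz)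
  also have "\<dots> = 0" by (simp only: of_int_mult of_int_of_nat_eq assms mult_zero_left)
  finally show "Poly_Mapping.lookup (taylor_coef e (Poly_Mapping.map (pdz i) P)) m =
    Poly_Mapping.lookup (0 :: 'f mpoly) m" by simp
qed

lemma pdz_fzs: "pdz i (fzs k b q j) = (if i = j then 1 else 0)"
  by (simp add: fzs_def pdz_add pdz_Var)

lemma inner_derivative_fzs:
  assumes "i \<in> {1..k}"
  shows "Poly_Mapping.map (pdz i) (fzs k b q j) = Const (Const (b i j))"
proof -
  have Var: "Poly_Mapping.map (pdz i) (Var j) = (0 :: int mpoly mpoly)"
    by (simp add: Var_def map_single_zero derivation_zero_one(2)[OF derivation_pdz])
  have Const: "Poly_Mapping.map (pdz i) (Const c) = (Const (pdz i c) :: int mpoly mpoly)" for c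
    by (simp add: Const_def map_single_zero)
  show ?thesis using assms
    by (simp add: fzs_def derivationD(1)[OF derivation_map[OF derivation_pdz]] Var Const
      pdz_add pdz_sum pdz_Const_mult pdz_Var if_distrib cong: if_cong)
qed

lemma Icoef_eq_ycoef:
  "(Icoef n k b q A e S :: 'f::ring_1 mpoly) =
    Const (of_int (dval k b S)) * ycoef n k b q e (\<lambda>j. A j - (if j \<in> S then 1 else 0))"
  by (simp add: Icoef_def Xpoly_def ycoef_def Ymon_def taylor_coef_Const_mult flip: taylor_coef_def)

lemma Ymon_reduce:
  "(\<Prod>i\<in>{1..n}. fzs k b q i ^ (m i - (if i = j then 1 else 0))) = Ymon n k b q (m(j := m j - 1))"
  unfolding Ymon_def by (intro prod.cong) auto

lemma pdz_ycoef:
  assumes "i \<in> {1..n}"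
  shows "pdz i (ycoef n k b q e m :: 'f::comm_ring_1 mpoly) =
    of_nat (m i) * ycoef n k b q e (m(i := m i - 1))"
proof -
  have "pdz i (Ymon n k b q m) = of_nat (m i) * Ymon n k b q (m(i := m i - 1))"
    unfolding Ymon_def[of n k b q m] derivation_prod_power[OF derivation_pdz finite_atLeastAtMost]
      Ymon_reduce
    using assms by (simp add: pdz_fzs if_distrib if_distribR cong: if_cong)
  \<comment> \<open>Written as a doubly constant polynomial, the scalar can be pulled out of
    \<open>taylor_coef\<close>.\<close>
  also have "of_nat (m i) = Const (Const (int (m i)))" by (simp add: Const_of_nat)
  finally have "pdz i (Ymon n k b q m) = Const (Const (int (m i))) * Ymon n k b q (m(i := m i - 1))" .
  from arg_cong[OF this, of "taylor_coef e"]
  have "pdz i (ycoef n k b q e m :: 'f mpoly) =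
      Const (of_int (int (m i))) * ycoef n k b q e (m(i := m i - 1))"
    by (simp only: ycoef_def taylor_coef_pdz taylor_coef_Const_mult)
  then show ?thesis by (simp only: of_int_of_nat_eq Const_of_nat)
qed

text \<open>The coefficients of a Taylor expansion at exponents congruent to $-1$ modulo $p$ vanish on
  derivatives, so they behave like an integral over a closed cycle.\<close>

lemma ycoef_total_derivative:
  assumes "(of_nat (Poly_Mapping.lookup e i + 1) :: 'f::comm_ring_1) = 0" "i \<in> {1..k}"
  shows "(\<Sum>j\<in>{1..n}. of_nat (m j) * Const (of_int (b i j)) *
    (ycoef n k b q e (m(j := m j - 1)) :: 'f mpoly)) = 0"
proof -
  have "Poly_Mapping.map (pdz i) (Ymon n k b q m) =
    (\<Sum>j\<in>{1..n}. of_nat (m j) * Const (Const (b i j)) * Ymon n k b q (m(j := m j - 1)))"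
    unfolding Ymon_def[of n k b q m]
      derivation_prod_power[OF derivation_map[OF derivation_pdz] finite_atLeastAtMost] Ymon_reduce
    by (simp add: inner_derivative_fzs[OF assms(2)])
  also have "\<dots> = (\<Sum>j\<in>{1..n}. Const (Const (int (m j) * b i j)) * Ymon n k b q (m(j := m j - 1)))"
    by (simp add: Const_mult Const_of_nat)
  finally have "taylor_coef e (Poly_Mapping.map (pdz i) (Ymon n k b q m)) =
    (\<Sum>j\<in>{1..n}. Const (of_int (int (m j) * b i j)) * (ycoef n k b q e (m(j := m j - 1)) :: 'f mpoly))"
    by (simp only: taylor_coef_sum taylor_coef_Const_mult ycoef_def)
  also have "\<dots> = (\<Sum>j\<in>{1..n}. of_nat (m j) * Const (of_int (b i j)) *
    (ycoef n k b q e (m(j := m j - 1)) :: 'f mpoly))"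
    by (simp add: Const_mult Const_of_nat)
  finally show ?thesis using taylor_coef_inner_derivative[OF assms(1)] by metis
qed

text \<open>Raising the exponent of f_j by 1 multiplies the product by f_j, and the sum of lambda_j
  f_j is the sum of lambda_j z_j, because the g_j parts cancel by the relation.\<close>

lemma ycoef_relation:
  assumes "\<forall>t\<in>{1..k}. (\<Sum>j\<in>{1..n}. lam j * b t j) = 0"
  shows "(\<Sum>j\<in>{1..n}. Const (of_int (lam j)) * ycoef n k b q e (m(j := m j + 1))) =
    fC n lam * (ycoef n k b q e m :: 'f::comm_ring_1 mpoly)"
proof -
  let ?Y = "Ymon n k b q m"
  have Y: "Ymon n k b q (m(j := m j + 1)) = fzs k b q j * ?Y" if "j \<in> {1..n}" for j
  proof -
    have "Ymon n k b q (m(j := m j + 1)) = (\<Prod>i\<in>{1..n}. (if i = j then fzs k b q j else 1) * fzs k b q i ^ m i)"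
      unfolding Ymon_def by (intro prod.cong) auto
    then show ?thesis using that by (simp add: prod.distrib Ymon_def)
  qed
  \<comment> \<open>This is g_j(q + s), the part of f_j free of z.\<close>
  define g :: "nat \<Rightarrow> int mpoly" where
    "g j = Const (\<Sum>i\<in>{1..k}. b i j * q i) + (\<Sum>i\<in>{1..k}. Const (b i j) * Var i)" for j
  have fzs: "fzs k b q j = Var j + Const (g j)" for j
    by (simp add: fzs_def g_def)
  have "(\<Sum>j\<in>{1..n}. Const (lam j) * g j) =
    Const (\<Sum>j\<in>{1..n}. \<Sum>i\<in>{1..k}. lam j * (b i j * q i)) +
    (\<Sum>j\<in>{1..n}. \<Sum>i\<in>{1..k}. Const (lam j * b i j) * Var i)"
    by (simp add: g_def distrib_left sum.distrib Const_sum Const_mult sum_distrib_left mult.assoc)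
  also have "(\<Sum>j\<in>{1..n}. \<Sum>i\<in>{1..k}. lam j * (b i j * q i)) =
    (\<Sum>i\<in>{1..k}. (\<Sum>j\<in>{1..n}. lam j * b i j) * q i)"
    by (subst sum.swap) (simp add: sum_distrib_right mult.assoc)
  also have "(\<Sum>j\<in>{1..n}. \<Sum>i\<in>{1..k}. Const (lam j * b i j) * Var i) =
    (\<Sum>i\<in>{1..k}. Const (\<Sum>j\<in>{1..n}. lam j * b i j) * (Var i :: int mpoly))"
    by (subst sum.swap) (simp add: sum_distrib_right Const_sum)
  finally have rel: "(\<Sum>j\<in>{1..n}. Const (lam j) * g j) = 0"
    using assms by simp
  have "(\<Sum>j\<in>{1..n}. Const (Const (lam j)) * Ymon n k b q (m(j := m j + 1))) =
    (\<Sum>j\<in>{1..n}. Const (Const (lam j)) * (fzs k b q j * ?Y))"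
    using Y by (intro sum.cong) auto
  also have "\<dots> = (\<Sum>j\<in>{1..n}. Const (Const (lam j)) * (Var j * ?Y)) + Const (\<Sum>j\<in>{1..n}. Const (lam j) * g j) * ?Y"
    by (simp only: fzs distrib_left distrib_right sum.distrib Const_sum
      sum_distrib_right Const_mult mult.assoc)
  finally have eq: "(\<Sum>j\<in>{1..n}. Const (Const (lam j)) * Ymon n k b q (m(j := m j + 1))) =
    (\<Sum>j\<in>{1..n}. Const (Const (lam j)) * (Var j * ?Y))"
    by (simp only: rel Const_0 mult_zero_left add_0_right)
  have "(taylor_coef e (\<Sum>j\<in>{1..n}. Const (Const (lam j)) * Ymon n k b q (m(j := m j + 1))) :: 'f mpoly) =
     taylor_coef e (\<Sum>j\<in>{1..n}. Const (Const (lam j)) * (Var j * ?Y))"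
    by (simp only: eq)
  then show ?thesis
    by (simp only: taylor_coef_sum taylor_coef_Const_mult taylor_coef_Var_mult ycoef_def fC_def
      sum_distrib_right mult.assoc)
qed

subsection \<open>Signs of lists and alternating functions\<close>

lemma lsign_Nil [simp]: "lsign [] = 1"
  by (simp add: lsign_def)

text \<open>The inversions starting at position 0 correspond to the entries of the tail smaller than
  \<open>x\<close>; all others are inversions of the tail.\<close>

lemma lsign_Cons: "lsign (x # xs) = (-1) ^ length (filter (\<lambda>y. y < x) xs) * lsign xs"
proof -
  let ?inv = "\<lambda>xs::nat list. {(u, v). u < v \<and> v < length xs \<and> xs ! v < xs ! u}"
  let ?X = "(\<lambda>v. (0::nat, Suc v)) ` {v. v < length xs \<and> xs ! v < x}"
  let ?Y = "(\<lambda>(u, v). (Suc u, Suc v)) ` ?inv xs"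
  have fin: "finite (?inv xs)"
    by (rule finite_subset[of _ "{..<length xs} \<times> {..<length xs}"]) auto
  have "?inv (x # xs) = ?X \<union> ?Y"
  proof (intro set_eqI iffI)
    fix uv assume "uv \<in> ?inv (x # xs)"
    then obtain u v where uv: "uv = (u, v)" "u < v" "v < Suc (length xs)" "(x # xs) ! v < (x # xs) ! u"
      by auto
    then obtain v' where v': "v = Suc v'" by (cases v) auto
    show "uv \<in> ?X \<union> ?Y"
    proof (cases u)
      case 0
      then show ?thesis using uv v' by auto
    next
      case (Suc u')
      then have "(u', v') \<in> ?inv xs" using uv v' by auto
      then have "(\<lambda>(u, v). (Suc u, Suc v)) (u', v') \<in> ?Y" by (rule imageI)
      then show ?thesis using uv v' Suc by simp
    qed
  qed auto
  moreover have "?X \<inter> ?Y = {}" by auto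
  moreover have "card ?X = length (filter (\<lambda>y. y < x) xs)"
    by (subst card_image) (auto simp: inj_on_def length_filter_conv_card)
  moreover have "card ?Y = card (?inv xs)"
    by (rule card_image) (auto simp: inj_on_def)
  ultimately have "card (?inv (x # xs)) = length (filter (\<lambda>y. y < x) xs) + card (?inv xs)"
    using fin card_Un_disjoint[of ?X ?Y] by simp
  then show ?thesis by (simp add: lsign_def power_add)
qed

lemma lsign_square [simp]: "lsign xs * lsign xs = 1"
  unfolding lsign_def power_add[symmetric] by (simp add: minus_one_power_iff)

text \<open>Adjacent swaps generate all reorderings, so sign arguments become list inductions. The
  length is fixed because \<open>Det k\<close> reads only the first k entries of its list.\<close>

definition alternating :: "nat \<Rightarrow> (nat list \<Rightarrow> 'a::comm_ring_1) \<Rightarrow> bool" where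
  "alternating k \<Phi> \<longleftrightarrow>
    (\<forall>P x y Q. length (P @ x # y # Q) = k \<longrightarrow> \<Phi> (P @ x # y # Q) = - \<Phi> (P @ y # x # Q))"

lemma alternatingD:
  "alternating k \<Phi> \<Longrightarrow> length (P @ x # y # Q) = k \<Longrightarrow> \<Phi> (P @ x # y # Q) = - \<Phi> (P @ y # x # Q)"
  unfolding alternating_def by blast

text \<open>While being inserted, \<open>x\<close> passes precisely the smaller entries, one
  adjacent swap each.\<close>

lemma alternating_insort:
  assumes "alternating k \<Phi>" "length (P @ x # xs) = k" "sorted xs"
  shows "\<Phi> (P @ x # xs) = (-1) ^ length (filter (\<lambda>y. y < x) xs) * \<Phi> (P @ insort x xs)"
  using assms(2,3)
proof (induction xs arbitrary: P)
  case (Cons y ys)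
  show ?case
  proof (cases "x \<le> y")
    case True
    then have "filter (\<lambda>z. z < x) (y # ys) = []" using Cons.prems by (auto simp: filter_empty_conv)
    then show ?thesis using True by simp
  next
    case False
    have "\<Phi> (P @ x # y # ys) = - \<Phi> ((P @ [y]) @ x # ys)"
      using alternatingD[OF assms(1) Cons.prems(1)] by simp
    also have "\<dots> = - ((-1) ^ length (filter (\<lambda>y. y < x) ys) * \<Phi> ((P @ [y]) @ insort x ys))"
      using Cons.prems by (subst Cons.IH) auto
    finally show ?thesis using False by simp
  qed
qed simp

text \<open>Insertion sort performs as many swaps as there are inversions. The prefix
  \<open>P\<close> collects the heads during the recursion, since alternation is available only for
  the whole list of length k.\<close>

lemma alternating_sort:
  assumes "alternating k \<Phi>" "length (P @ xs) = k"
  shows "\<Phi> (P @ xs) = lsign xs * \<Phi> (P @ sort xs)"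
  using assms(2)
proof (induction xs arbitrary: P)
  case (Cons x xs)
  have "\<Phi> (P @ x # xs) = lsign xs * \<Phi> (P @ x # sort xs)"
    using Cons.IH[of "P @ [x]"] Cons.prems by simp
  also have "\<Phi> (P @ x # sort xs) =
      (-1) ^ length (filter (\<lambda>y. y < x) (sort xs)) * \<Phi> (P @ insort x (sort xs))"
    using Cons.prems by (intro alternating_insort[OF assms(1)]) auto
  also have "length (filter (\<lambda>y. y < x) (sort xs)) = length (filter (\<lambda>y. y < x) xs)"
    by (simp add: filter_sort)
  finally show ?case by (simp add: lsign_Cons mult_ac)
qed simp

lemma alternating_move:
  assumes "alternating k \<Phi>" "length (R @ P @ x # Q) = k"
  shows "\<Phi> (R @ P @ x # Q) = (-1) ^ length P * \<Phi> (R @ x # P @ Q)"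
  using assms(2)
proof (induction P arbitrary: R)
  case (Cons p P)
  have "\<Phi> (R @ (p # P) @ x # Q) = (-1) ^ length P * \<Phi> ((R @ [p]) @ x # P @ Q)"
    using Cons.IH[of "R @ [p]"] Cons.prems by simp
  also have "\<Phi> ((R @ [p]) @ x # P @ Q) = - \<Phi> (R @ x # p # P @ Q)"
    using alternatingD[OF assms(1), of R p x "P @ Q"] Cons.prems by simp
  finally show ?case by simp
qed simp

subsection \<open>Minors\<close>

text \<open>The minor with columns in list order, repetitions allowed; \<open>dval\<close> is its
  value on the sorted list.\<close>

definition Det :: "nat \<Rightarrow> (nat \<Rightarrow> nat \<Rightarrow> int) \<Rightarrow> nat list \<Rightarrow> int" where
  "Det k b xs = (\<Sum>\<sigma> | \<sigma> permutes {1..k}. sign \<sigma> * (\<Prod>i\<in>{1..k}. b i (xs ! (\<sigma> i - 1))))"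

text \<open>Signed minor at row i in the expansion along the first column. That column is absent
  from \<open>js\<close> and list positions start at 0, hence the shift by 2.\<close>

definition cofactor :: "nat \<Rightarrow> (nat \<Rightarrow> nat \<Rightarrow> int) \<Rightarrow> nat \<Rightarrow> nat list \<Rightarrow> int" where
  "cofactor k b i js = (\<Sum>\<sigma> | \<sigma> permutes {1..k} \<and> \<sigma> i = 1.
    sign \<sigma> * (\<Prod>s\<in>{1..k} - {i}. b s (js ! (\<sigma> s - 2))))"

lemma dval_eq_Det: "dval k b S = Det k b (sorted_list_of_set S)"
  by (simp add: dval_def Det_def)

lemma alternating_Det: "alternating k (Det k b)"
  unfolding alternating_def
proof (intro allI impI)
  fix P Q :: "nat list" and x y assume len: "length (P @ x # y # Q) = k"
  \<comment> \<open>Columns are numbered from 1 and list positions from 0, so \<open>x\<close> and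
    \<open>y\<close> occupy columns \<open>length P + 1\<close> and
    \<open>length P + 2\<close>.\<close>
  define \<tau> where "\<tau> = transpose (Suc (length P)) (Suc (Suc (length P)))"
  have \<tau>: "\<tau> permutes {1..k}"
    unfolding \<tau>_def using len by (intro permutes_swap_id) auto
  have nth: "(P @ x # y # Q) ! (\<tau> u - 1) = (P @ y # x # Q) ! (u - 1)" if "u \<ge> 1" for u
  proof -
    consider "u = Suc (length P)" | "u = Suc (Suc (length P))" | "u < Suc (length P)"
      | "u > Suc (Suc (length P))" by linarith
    then show ?thesis
    proof cases
      case 4
      then have "u - 1 - length P = Suc (Suc (u - 1 - length P - 2))" by simp
      then show ?thesis using 4 by (simp add: \<tau>_def transpose_def nth_append)
    qed (use that in \<open>auto simp: \<tau>_def transpose_def nth_append\<close>)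
  qed
  have "Det k b (P @ x # y # Q) = (\<Sum>\<sigma> | \<sigma> permutes {1..k}.
      sign (\<tau> \<circ> \<sigma>) * (\<Prod>i\<in>{1..k}. b i ((P @ x # y # Q) ! ((\<tau> \<circ> \<sigma>) i - 1))))"
    unfolding Det_def by (rule setum_permutations_compose_left[OF \<tau>])
  also have "\<dots> = (\<Sum>\<sigma> | \<sigma> permutes {1..k}.
      - (sign \<sigma> * (\<Prod>i\<in>{1..k}. b i ((P @ y # x # Q) ! (\<sigma> i - 1)))))"
  proof (rule sum.cong)
    fix \<sigma> assume "\<sigma> \<in> {\<sigma>. \<sigma> permutes {1..k}}"
    then have \<sigma>: "\<sigma> permutes {1..k}" by simp
    have "sign (\<tau> \<circ> \<sigma>) = sign \<tau> * sign \<sigma>"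
      using \<sigma> \<tau> by (intro sign_compose) (auto simp: permutation_permutes)
    moreover have "sign \<tau> = -1" by (simp add: \<tau>_def sign_swap_id)
    moreover have "\<sigma> i \<ge> 1" if "i \<in> {1..k}" for i
      using permutes_in_image[OF \<sigma>, of i] that by simp
    moreover from this have "(\<Prod>i\<in>{1..k}. b i ((P @ x # y # Q) ! ((\<tau> \<circ> \<sigma>) i - 1))) =
        (\<Prod>i\<in>{1..k}. b i ((P @ y # x # Q) ! (\<sigma> i - 1)))"
      using nth by (intro prod.cong) auto
    ultimately show "sign (\<tau> \<circ> \<sigma>) * (\<Prod>i\<in>{1..k}. b i ((P @ x # y # Q) ! ((\<tau> \<circ> \<sigma>) i - 1))) =
      - (sign \<sigma> * (\<Prod>i\<in>{1..k}. b i ((P @ y # x # Q) ! (\<sigma> i - 1))))"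
      by simp
  qed simp
  finally show "Det k b (P @ x # y # Q) = - Det k b (P @ y # x # Q)"
    by (simp add: Det_def sum_negf)
qed

text \<open>Group the permutations by the row that they send to column 1.\<close>

lemma Det_Cons:
  assumes "k > 0"
  shows "Det k b (j # js) = (\<Sum>i\<in>{1..k}. b i j * cofactor k b i js)"
proof -
  define F where "F \<sigma> = sign \<sigma> * (\<Prod>i\<in>{1..k}. b i ((j # js) ! (\<sigma> i - 1)))" for \<sigma>
  have "Det k b (j # js) = (\<Sum>\<sigma> | \<sigma> permutes {1..k}. \<Sum>i\<in>{1..k}. if \<sigma> i = 1 then F \<sigma> else 0)"
    unfolding Det_def F_def[symmetric]
  proof (rule sum.cong)
    fix \<sigma> assume "\<sigma> \<in> {\<sigma>. \<sigma> permutes {1..k}}"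
    then have \<sigma>: "\<sigma> permutes {1..k}" by simp
    have iff: "\<sigma> i = 1 \<longleftrightarrow> i = inv \<sigma> 1" for i
      using permutes_inv_eq[OF \<sigma>, of 1 i] by auto
    have "(\<Sum>i\<in>{1..k}. if \<sigma> i = 1 then F \<sigma> else 0) = (\<Sum>i\<in>{1..k}. if i = inv \<sigma> 1 then F \<sigma> else 0)"
      by (simp only: iff)
    also have "\<dots> = F \<sigma>"
      using permutes_in_image[OF permutes_inv[OF \<sigma>], of 1] assms by simp
    finally show "F \<sigma> = (\<Sum>i\<in>{1..k}. if \<sigma> i = 1 then F \<sigma> else 0)" by simp
  qed simp
  also have "\<dots> = (\<Sum>i\<in>{1..k}. \<Sum>\<sigma> | \<sigma> permutes {1..k}. if \<sigma> i = 1 then F \<sigma> else 0)"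
    by (rule sum.swap)
  also have "\<dots> = (\<Sum>i\<in>{1..k}. \<Sum>\<sigma> | \<sigma> permutes {1..k} \<and> \<sigma> i = 1. F \<sigma>)"
  proof (rule sum.cong)
    fix i
    show "(\<Sum>\<sigma> | \<sigma> permutes {1..k}. if \<sigma> i = 1 then F \<sigma> else 0) =
        (\<Sum>\<sigma> | \<sigma> permutes {1..k} \<and> \<sigma> i = 1. F \<sigma>)"
      using sum.inter_filter[of "{\<sigma>. \<sigma> permutes {1..k}}" F "\<lambda>\<sigma>. \<sigma> i = 1"]
      by (simp add: finite_permutations)
  qed simp
  also have "\<dots> = (\<Sum>i\<in>{1..k}. b i j * cofactor k b i js)"
  proof (rule sum.cong)
    fix i assume i: "i \<in> {1..k}"
    show "(\<Sum>\<sigma> | \<sigma> permutes {1..k} \<and> \<sigma> i = 1. F \<sigma>) = b i j * cofactor k b i js"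
      unfolding cofactor_def sum_distrib_left
    proof (rule sum.cong)
      fix \<sigma> assume "\<sigma> \<in> {\<sigma>. \<sigma> permutes {1..k} \<and> \<sigma> i = 1}"
      then have \<sigma>: "\<sigma> permutes {1..k}" and \<sigma>i: "\<sigma> i = 1" by auto
      have "(j # js) ! (\<sigma> s - 1) = js ! (\<sigma> s - 2)" if "s \<in> {1..k} - {i}" for s
      proof -
        have "\<sigma> s \<noteq> \<sigma> i" using permutes_inj[OF \<sigma>] that by (auto dest: injD)
        moreover have "\<sigma> s \<ge> 1" using permutes_in_image[OF \<sigma>, of s] that by simp
        ultimately have "\<sigma> s - 1 = Suc (\<sigma> s - 2)" using \<sigma>i by simp
        then show ?thesis by simp
      qed
      then have "(\<Prod>s\<in>{1..k} - {i}. b s ((j # js) ! (\<sigma> s - 1))) =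
          (\<Prod>s\<in>{1..k} - {i}. b s (js ! (\<sigma> s - 2)))"
        by (intro prod.cong) auto
      moreover have "(\<Prod>s\<in>{1..k}. b s ((j # js) ! (\<sigma> s - 1))) =
          b i j * (\<Prod>s\<in>{1..k} - {i}. b s ((j # js) ! (\<sigma> s - 1)))"
        by (subst prod.remove[OF finite_atLeastAtMost i]) (simp_all add: \<sigma>i)
      ultimately show "F \<sigma> = b i j * (sign \<sigma> * (\<Prod>s\<in>{1..k} - {i}. b s (js ! (\<sigma> s - 2))))"
        unfolding F_def by (simp only: mult_ac)
    qed simp
  qed simp
  finally show ?thesis .
qed

text \<open>Make the two equal columns adjacent; swapping them gives d = -d in Z.\<close>

lemma Det_not_distinct:
  assumes "length xs = k" "\<not> distinct xs"
  shows "Det k b xs = 0"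
proof -
  obtain ws y ys zs where xs: "xs = ws @ [y] @ ys @ [y] @ zs"
    using not_distinct_decomp[OF assms(2)] by blast
  have "Det k b ((ws @ [y]) @ ys @ y # zs) = (-1) ^ length ys * Det k b ((ws @ [y]) @ y # ys @ zs)"
    using assms(1) xs by (intro alternating_move[OF alternating_Det]) simp
  moreover have "Det k b (ws @ y # y # ys @ zs) = 0"
    using alternatingD[OF alternating_Det, of ws y y "ys @ zs" k b] assms(1) xs by simp
  ultimately show ?thesis using xs by simp
qed

lemma Det_eq_lsign_dval:
  assumes "length xs = k" "distinct xs"
  shows "Det k b xs = lsign xs * dval k b (set xs)"
proof -
  have "sorted_list_of_set (set xs) = sort xs"
    using assms(2) by (metis sorted_list_of_set_sort_remdups distinct_remdups_id)
  then show ?thesis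
    using alternating_sort[OF alternating_Det, of "[]" xs k b] assms(1) by (simp add: dval_eq_Det)
qed

text \<open>The determinant is linear in its first column, so a relation among the forms passes to
  minors sharing the other columns.\<close>

lemma Det_relation:
  assumes "k > 0" "\<forall>i\<in>{1..k}. (\<Sum>j\<in>X. c j * of_int (b i j)) = (0::'f::comm_ring_1)"
  shows "(\<Sum>j\<in>X. c j * of_int (Det k b (j # us))) = 0"
proof -
  have "(\<Sum>j\<in>X. c j * of_int (Det k b (j # us))) =
      (\<Sum>j\<in>X. \<Sum>i\<in>{1..k}. c j * of_int (b i j) * of_int (cofactor k b i us))"
    by (simp add: Det_Cons[OF assms(1)] sum_distrib_left mult.assoc)
  also have "\<dots> = (\<Sum>i\<in>{1..k}. (\<Sum>j\<in>X. c j * of_int (b i j)) * of_int (cofactor k b i us))"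
    by (subst sum.swap) (simp add: sum_distrib_right)
  also have "\<dots> = 0" using assms(2) by simp
  finally show ?thesis .
qed

text \<open>Cramer's rule: all columns of the relation other than \<open>x\<close> and
  \<open>y\<close> already occur in \<open>us\<close>, so their minors vanish and two terms
  remain.\<close>

lemma Det_exchange:
  assumes "k > 0" "\<forall>i\<in>{1..k}. (\<Sum>j\<in>X. c j * of_int (b i j)) = (0::'f::comm_ring_1)"
    and "finite X" "x \<in> X" "y \<in> X" "x \<noteq> y" "\<And>j. j \<in> X - {x, y} \<Longrightarrow> c j \<noteq> 0 \<Longrightarrow> j \<in> set us"
    and "length us = k - 1"
  shows "c x * of_int (Det k b (x # us)) = - (c y * of_int (Det k b (y # us)))"
proof -
  have zero: "c j * of_int (Det k b (j # us)) = 0" if "j \<in> X - {x, y}" for j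
  proof (cases "c j = 0")
    case False
    then have "Det k b (j # us) = 0" using assms(1,7,8) that by (intro Det_not_distinct) auto
    then show ?thesis by simp
  qed simp
  have "0 = (\<Sum>j\<in>X. c j * of_int (Det k b (j # us)))"
    using Det_relation[OF assms(1,2)] by metis
  also have "\<dots> = (\<Sum>j\<in>{x, y}. c j * of_int (Det k b (j # us)))"
    using assms(3-5) zero by (intro sum.mono_neutral_right) auto
  also have "\<dots> = c x * of_int (Det k b (x # us)) + c y * of_int (Det k b (y # us))"
    using assms(6) by simp
  finally show ?thesis by (simp add: eq_neg_iff_add_eq_0)
qed

text \<open>Bring a column with nonzero coefficient to the front; in the contracted relation every
  other term repeats a column. This serves over the complex numbers for \<open>indep_sets\<close>
  and over the finite field for bases modulo p.\<close>

lemma Det_lin_dep: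
  assumes "k > 0" "length xs = k" "lin_dep (of_int :: int \<Rightarrow> 'f::field) k b (set xs)"
  shows "(of_int (Det k b xs) :: 'f) = 0"
proof (cases "distinct xs")
  case True
  obtain c :: "nat \<Rightarrow> 'f" and j where c: "j \<in> set xs" "c j \<noteq> 0"
    "\<forall>i\<in>{1..k}. (\<Sum>j\<in>set xs. c j * of_int (b i j)) = 0"
    using assms(3) unfolding lin_dep_def by blast
  obtain P Q where xs: "xs = P @ j # Q" using c(1) by (meson split_list)
  have "(\<Sum>s\<in>set xs. c s * of_int (Det k b (s # P @ Q))) = c j * of_int (Det k b (j # P @ Q))"
  proof -
    have "Det k b (i # P @ Q) = 0" if "i \<in> set xs - {j}" for i
      using assms(2) xs that by (intro Det_not_distinct) auto
    then have "(\<Sum>s\<in>set xs. c s * of_int (Det k b (s # P @ Q))) =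
        (\<Sum>s\<in>{j}. c s * of_int (Det k b (s # P @ Q)))"
      using c(1) by (intro sum.mono_neutral_right) auto
    then show ?thesis by simp
  qed
  then have "of_int (Det k b (j # P @ Q)) = (0::'f)"
    using Det_relation[OF assms(1) c(3)] c(2) by simp
  moreover have "Det k b ([] @ P @ j # Q) = (-1) ^ length P * Det k b ([] @ j # P @ Q)"
    using assms(2) xs by (intro alternating_move[OF alternating_Det]) simp
  ultimately show ?thesis using xs by simp
next
  case False
  then show ?thesis using Det_not_distinct assms(2) by simp
qed

subsection \<open>Linear dependence and fundamental circuits\<close>

text \<open>Gaussian elimination by induction on the number of equations. It makes any k + 1 of the
  forms dependent.\<close>

lemma homogeneous_system_solution:
  fixes M :: "nat \<Rightarrow> 'a \<Rightarrow> 'f::field"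
  assumes "finite S" "card S > k"
  shows "\<exists>c. (\<exists>j\<in>S. c j \<noteq> 0) \<and> (\<forall>i\<in>{1..k}. (\<Sum>j\<in>S. c j * M i j) = 0)"
  using assms
proof (induction k arbitrary: S M)
  case 0
  then have "S \<noteq> {}" by auto
  then show ?case by (intro exI[of _ "\<lambda>_. 1"]) auto
next
  case (Suc k)
  show ?case
  proof (cases "\<forall>j\<in>S. M (Suc k) j = 0")
    case True
    obtain c where "\<exists>j\<in>S. c j \<noteq> 0" "\<forall>i\<in>{1..k}. (\<Sum>j\<in>S. c j * M i j) = 0"
      using Suc.IH[of S M] Suc.prems by auto
    moreover from this True have "\<forall>i\<in>{1..Suc k}. (\<Sum>j\<in>S. c j * M i j) = 0"
      by (auto simp: le_Suc_eq)
    ultimately show ?thesis by blast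
  next
    case False
    then obtain x where x: "x \<in> S" "M (Suc k) x \<noteq> 0" by blast
    \<comment> \<open>The last equation, with pivot \<open>x\<close>, expresses the unknown at
      \<open>x\<close> as minus the sum of \<open>c j * r j\<close>; substituting it leaves k
      equations on \<open>S - {x}\<close>.\<close>
    define r where "r j = M (Suc k) j / M (Suc k) x" for j
    have "card (S - {x}) > k" using Suc.prems x by simp
    then obtain c where c: "\<exists>j\<in>S - {x}. c j \<noteq> 0"
      "\<forall>i\<in>{1..k}. (\<Sum>j\<in>S - {x}. c j * (M i j - M i x * r j)) = 0"
      using Suc.IH[of "S - {x}" "\<lambda>i j. M i j - M i x * r j"] Suc.prems by blast
    define c' where "c' = c(x := - (\<Sum>j\<in>S - {x}. c j * r j))"
    have split: "(\<Sum>j\<in>S. c' j * M i j) = (\<Sum>j\<in>S - {x}. c j * (M i j - M i x * r j))" for i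
    proof -
      have "(\<Sum>j\<in>S. c' j * M i j) = c' x * M i x + (\<Sum>j\<in>S - {x}. c' j * M i j)"
        using Suc.prems x by (simp add: sum.remove)
      also have "(\<Sum>j\<in>S - {x}. c' j * M i j) = (\<Sum>j\<in>S - {x}. c j * M i j)"
        by (intro sum.cong) (auto simp: c'_def)
      finally show ?thesis
        by (simp add: c'_def right_diff_distrib sum_subtractf sum_distrib_left sum_distrib_right mult_ac)
    qed
    have "(\<Sum>j\<in>S. c' j * M i j) = 0" if "i \<in> {1..Suc k}" for i
    proof (cases "i = Suc k")
      case True
      then show ?thesis using x(2) by (simp add: split r_def)
    next
      case False
      then show ?thesis using c(2) that by (simp add: split)
    qed
    moreover have "\<exists>j\<in>S. c' j \<noteq> 0" using c(1) by (auto simp: c'_def)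
    ultimately show ?thesis by blast
  qed
qed

lemma lin_dep_mono:
  assumes "lin_dep \<phi> k b C" "C \<subseteq> D" "finite D"
  shows "lin_dep \<phi> k b D"
proof -
  obtain c where c: "\<exists>j\<in>C. c j \<noteq> 0" "\<forall>i\<in>{1..k}. (\<Sum>j\<in>C. c j * \<phi> (b i j)) = 0"
    using assms(1) unfolding lin_dep_def by blast
  have "(\<Sum>j\<in>D. (if j \<in> C then c j else 0) * \<phi> (b i j)) = (\<Sum>j\<in>C. c j * \<phi> (b i j))" for i
    using assms by (intro sum.mono_neutral_cong_right) auto
  then show ?thesis unfolding lin_dep_def using c assms(2)
    by (intro exI[of _ "\<lambda>j. if j \<in> C then c j else 0"]) auto
qed

lemma lin_dep_contains_circuit:
  assumes "finite S" "lin_dep \<phi> k b S"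
  shows "\<exists>C\<subseteq>S. is_circuit \<phi> k b C"
  using assms
proof (induction S rule: finite_psubset_induct)
  case (psubset S)
  show ?case
  proof (cases "\<exists>D. D \<subset> S \<and> lin_dep \<phi> k b D")
    case True
    then obtain D where D: "D \<subset> S" "lin_dep \<phi> k b D" by blast
    then obtain C where "C \<subseteq> D" "is_circuit \<phi> k b C" using psubset.IH by metis
    then show ?thesis using D(1) by (intro exI[of _ C]) auto
  next
    case False
    then have "is_circuit \<phi> k b S" using psubset.prems by (simp add: is_circuit_def)
    then show ?thesis by blast
  qed
qed

text \<open>A zero coefficient would leave a nontrivial relation on a proper subset.\<close>

lemma circuit_relation_nonzero:
  fixes c :: "nat \<Rightarrow> 'f::field"
  assumes "is_circuit \<phi> k b C" "finite C" "\<exists>j\<in>C. c j \<noteq> 0"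
    "\<forall>i\<in>{1..k}. (\<Sum>j\<in>C. c j * \<phi> (b i j)) = 0" "x \<in> C"
  shows "c x \<noteq> 0"
proof
  assume "c x = 0"
  then have "(\<Sum>j\<in>C - {x}. c j * \<phi> (b i j)) = (\<Sum>j\<in>C. c j * \<phi> (b i j))" for i
    using assms(2) by (intro sum.mono_neutral_left) auto
  then have "\<forall>i\<in>{1..k}. (\<Sum>j\<in>C - {x}. c j * \<phi> (b i j)) = 0" using assms(4) by simp
  moreover have "\<exists>j\<in>C - {x}. c j \<noteq> 0" using assms(3) \<open>c x = 0\<close> by auto
  ultimately have "lin_dep \<phi> k b (C - {x})" unfolding lin_dep_def by metis
  moreover have "C - {x} \<subset> C" using assms(5) by auto
  ultimately show False using assms(1) by (simp add: is_circuit_def)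
qed

section \<open>Omitting one element of a circuit, and the matrix entries of L_C\<close>

lemma set_delete_nth:
  assumes "distinct cs" "i < length cs"
  shows "set (take i cs @ drop (Suc i) cs) = set cs - {cs ! i}"
    and "distinct (take i cs @ drop (Suc i) cs)"
proof -
  have cs: "cs = take i cs @ cs ! i # drop (Suc i) cs"
    using assms(2) by (rule id_take_nth_drop)
  have "distinct (take i cs @ cs ! i # drop (Suc i) cs)"
    using assms(1) cs by metis
  moreover have "set cs = set (take i cs @ cs ! i # drop (Suc i) cs)"
    using cs by metis
  ultimately show "set (take i cs @ drop (Suc i) cs) = set cs - {cs ! i}"
    and "distinct (take i cs @ drop (Suc i) cs)"
    by auto
qed

text \<open>Cramer's rule with the sign convention of L_C: moving \<open>cs ! v\<close>,
  respectively \<open>cs ! u\<close>, to the front makes the two lists differ only in their first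
  entry, and \<open>Det_exchange\<close> applies.\<close>

lemma Det_delete_nth:
  assumes "k > 0" "\<forall>t\<in>{1..k}. (\<Sum>j\<in>{1..n}. lam j * b t j) = 0"
    and "\<forall>j\<in>{1..n} - set cs. lam j = 0" "set cs \<subseteq> {1..n}" "distinct cs"
    and "u < length cs" "v < length cs" "length cs + length ss = Suc k"
  shows "lam (cs ! v) * (-1) ^ (u + v) * Det k b (take u cs @ drop (Suc u) cs @ ss) =
    lam (cs ! u) * Det k b (take v cs @ drop (Suc v) cs @ ss)"
proof -
  \<comment> \<open>The case u < v suffices: the identity is symmetric in u and v up to the sign
    (-1)^(u+v), whose square is 1.\<close>
  have less: "lam (cs ! v) * (-1) ^ (u + v) * Det k b (take u cs @ drop (Suc u) cs @ ss) =
      lam (cs ! u) * Det k b (take v cs @ drop (Suc v) cs @ ss)"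
    if uv: "u < v" "v < length cs" for u v
  proof -
    define P where "P = take u cs"
    define Q where "Q = take (v - Suc u) (drop (Suc u) cs)"
    define R where "R = drop (Suc v) cs @ ss"
    let ?x = "cs ! u" and ?y = "cs ! v"
    have d: "drop (Suc u) cs = Q @ ?y # drop (Suc v) cs"
      using id_take_nth_drop[of "v - Suc u" "drop (Suc u) cs"] uv by (simp add: Q_def)
    have cs: "cs = P @ ?x # Q @ ?y # drop (Suc v) cs"
      unfolding d[symmetric] P_def using uv by (intro id_take_nth_drop) simp
    have tv: "take v cs = P @ ?x # Q"
    proof -
      have "length (P @ ?x # Q) = v" using uv by (simp add: P_def Q_def)
      moreover have "(P @ ?x # Q) @ ?y # drop (Suc v) cs = cs" using cs by simp
      ultimately show ?thesis by (metis append_eq_conv_conj)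
    qed
    have len: "length P + length Q + length R = k - 1" "length P = u" "length Q = v - Suc u"
      using uv assms(1,8) by (auto simp: P_def Q_def R_def)
    have dist: "?x \<noteq> ?y" using assms(5) uv by (simp add: nth_eq_iff_index_eq)
    have "?x \<in> set cs" "?y \<in> set cs" using uv by simp_all
    then have mem: "?x \<in> {1..n}" "?y \<in> {1..n}" using assms(4) by blast+
    have ex: "lam ?x * of_int (Det k b (?x # P @ Q @ R)) = - (lam ?y * of_int (Det k b (?y # P @ Q @ R)))"
    proof (rule Det_exchange[where X = "{1..n}"])
      fix j assume j: "j \<in> {1..n} - {?x, ?y}" "lam j \<noteq> 0"
      then have "j \<in> set cs" using assms(3) by auto
      moreover have "set cs = set (P @ ?x # Q @ ?y # drop (Suc v) cs)" using cs by metis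
      ultimately show "j \<in> set (P @ Q @ R)" using j by (auto simp: R_def)
    qed (use assms(1,2) dist mem len in auto)
    have "Det k b (take u cs @ drop (Suc u) cs @ ss) = Det k b ([] @ (P @ Q) @ ?y # R)"
      by (simp add: d P_def R_def)
    also have "\<dots> = (-1) ^ length (P @ Q) * Det k b ([] @ ?y # (P @ Q) @ R)"
      using len assms(1) by (intro alternating_move[OF alternating_Det]) auto
    \<comment> \<open>Once the earlier entry \<open>cs ! u\<close> is omitted, \<open>cs ! v\<close>
      stands at position v - 1.\<close>
    finally have 1: "Det k b (take u cs @ drop (Suc u) cs @ ss) =
        (-1) ^ (v - 1) * Det k b (?y # P @ Q @ R)"
      using len uv by simp
    have "Det k b (take v cs @ drop (Suc v) cs @ ss) = Det k b ([] @ P @ ?x # Q @ R)"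
      by (simp add: tv R_def)
    also have "\<dots> = (-1) ^ length P * Det k b ([] @ ?x # P @ Q @ R)"
      using len assms(1) by (intro alternating_move[OF alternating_Det]) auto
    finally have 2: "Det k b (take v cs @ drop (Suc v) cs @ ss) = (-1) ^ u * Det k b (?x # P @ Q @ R)"
      using len by simp
    have sgn: "(-1::int) ^ (u + v) * (-1) ^ (v - 1) = - ((-1) ^ u)"
      using uv by (cases v) (auto simp: minus_one_power_iff)
    have ex': "- (lam ?y * Det k b (?y # P @ Q @ R)) = lam ?x * Det k b (?x # P @ Q @ R)"
      using ex by simp
    have "lam ?y * (-1) ^ (u + v) * ((-1) ^ (v - 1) * Det k b (?y # P @ Q @ R)) =
        ((-1) ^ (u + v) * (-1) ^ (v - 1)) * (lam ?y * Det k b (?y # P @ Q @ R))"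
      by (simp only: mult_ac)
    also have "\<dots> = (-1) ^ u * - (lam ?y * Det k b (?y # P @ Q @ R))"
      unfolding sgn by simp
    also have "\<dots> = lam ?x * ((-1) ^ u * Det k b (?x # P @ Q @ R))"
      unfolding ex' by (simp only: mult_ac)
    finally show ?thesis unfolding 1 2 .
  qed
  consider "u < v" | "u = v" | "v < u" by linarith
  then show ?thesis
  proof cases
    case 1
    then show ?thesis using less assms(7) by blast
  next
    case 2
    then show ?thesis by (simp add: minus_one_power_iff)
  next
    case 3
    have sq: "(-1::int) ^ (u + v) * (-1) ^ (u + v) = 1" by (simp add: minus_one_power_iff)
    have "lam (cs ! v) * (-1) ^ (u + v) * Det k b (take u cs @ drop (Suc u) cs @ ss) =
        (-1) ^ (u + v) * (lam (cs ! v) * Det k b (take u cs @ drop (Suc u) cs @ ss))"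
      by (simp only: mult_ac)
    also have "\<dots> = (-1) ^ (u + v) *
        (lam (cs ! u) * (-1) ^ (v + u) * Det k b (take v cs @ drop (Suc v) cs @ ss))"
      by (simp only: less[OF 3 assms(6)])
    also have "\<dots> = ((-1) ^ (u + v) * (-1) ^ (u + v)) *
        (lam (cs ! u) * Det k b (take v cs @ drop (Suc v) cs @ ss))"
      by (simp only: mult_ac add.commute)
    finally show ?thesis by (simp only: sq mult_1)
  qed
qed

text \<open>L_C trades one omitted element of C for another and leaves the part outside C fixed, so
  no other pair S, T is connected.\<close>

lemma Lbasis_eq_0:
  fixes C S T :: "nat set"
  assumes "finite C" "\<not> (\<exists>c\<in>C. S \<inter> C = C - {c}) \<or> \<not> (\<exists>c\<in>C. T \<inter> C = C - {c}) \<or> S - C \<noteq> T - C"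
    and "finite S"
  shows "Lbasis a C S T = (0 :: 'a::ring_1)"
proof (cases "\<exists>m<length (sorted_list_of_set C). S \<inter> C = C - {sorted_list_of_set C ! m}")
  case True
  let ?cs = "sorted_list_of_set C" and ?ss = "sorted_list_of_set (S - C)"
  have C: "\<exists>c\<in>C. S \<inter> C = C - {c}"
    using True assms(1) nth_mem set_sorted_list_of_set by metis
  have "Fvec ((take i ?cs @ drop (Suc i) ?cs) @ ?ss) T = (0::'a)" if i: "i < length ?cs" for i
  proof -
    have c: "?cs ! i \<in> C" using i assms(1) nth_mem set_sorted_list_of_set by metis
    have "set ((take i ?cs @ drop (Suc i) ?cs) @ ?ss) = (C - {?cs ! i}) \<union> (S - C)"
      using set_delete_nth(1)[OF _ i] assms(1,3) by (simp only: set_append[of _ ?ss]) simp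
    then have "T \<noteq> set ((take i ?cs @ drop (Suc i) ?cs) @ ?ss)"
      using assms(2) C c by auto
    then show ?thesis by (simp add: Fvec_def)
  qed
  with True show ?thesis by (simp add: Lbasis_def Let_def)
next
  case False
  show ?thesis unfolding Lbasis_def Let_def if_not_P[OF False] ..
qed

text \<open>Only the summand omitting \<open>cs ! v\<close> is supported at T. The first
  \<open>lsign\<close> rewrites F_S in the listed order, the last one comes from sorting the result.
  Counting positions from 0 instead of 1 does not change the parity of u + v.\<close>

lemma Lbasis_exchange:
  fixes C S T :: "nat set"
  defines "cs \<equiv> sorted_list_of_set C" and "ss \<equiv> sorted_list_of_set (S - C)"
  assumes "finite C" "finite S" "u < length cs" "v < length cs"
    and S: "S \<inter> C = C - {cs ! u}" and T: "T \<inter> C = C - {cs ! v}" and ST: "T - C = S - C"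
  shows "Lbasis a C S T = (lsign (take u cs @ drop (Suc u) cs @ ss) * (-1) ^ (u + v) *
    of_int (a (cs ! v)) * lsign (take v cs @ drop (Suc v) cs @ ss) :: 'a::ring_1)"
proof -
  have cs: "distinct cs" "set cs = C" using assms(3) by (simp_all add: cs_def)
  have ss: "distinct ss" "set ss = S - C" using assms(4) by (simp_all add: ss_def)
  have the: "(THE m. m < length cs \<and> S \<inter> C = C - {cs ! m}) = u"
  proof (rule the_equality)
    fix m assume m: "m < length cs \<and> S \<inter> C = C - {cs ! m}"
    then have "cs ! m = cs ! u" using S cs(2) nth_mem[of m cs] nth_mem[OF assms(5)] by blast
    then show "m = u" using m assms(5) cs(1) by (simp add: nth_eq_iff_index_eq)
  qed (use assms in auto)
  have Fvec: "Fvec (take m cs @ drop (Suc m) cs @ ss) T =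
      (if m = v then lsign (take v cs @ drop (Suc v) cs @ ss) else (0::'a))" if m: "m < length cs" for m
  proof -
    have set: "set (take m cs @ drop (Suc m) cs @ ss) = (C - {cs ! m}) \<union> (S - C)"
      using set_delete_nth(1)[OF cs(1) m] cs(2) ss(2) by auto
    have "T = set (take m cs @ drop (Suc m) cs @ ss) \<longleftrightarrow> cs ! m = cs ! v"
    proof
      assume "T = set (take m cs @ drop (Suc m) cs @ ss)"
      then have "T \<inter> C = C - {cs ! m}" unfolding set by auto
      then have "cs ! m \<notin> C - {cs ! v}" using T by auto
      then show "cs ! m = cs ! v" using nth_mem[OF m] cs(2) by auto
    next
      assume "cs ! m = cs ! v"
      then show "T = set (take m cs @ drop (Suc m) cs @ ss)"
        unfolding set using T ST by auto
    qed
    then have "T = set (take m cs @ drop (Suc m) cs @ ss) \<longleftrightarrow> m = v"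
      using m assms(6) cs(1) by (simp add: nth_eq_iff_index_eq)
    moreover have "distinct (take m cs @ drop (Suc m) cs @ ss)"
      using set_delete_nth[OF cs(1) m] ss cs(2) by auto
    ultimately show ?thesis by (auto simp: Fvec_def)
  qed
  have "Lbasis a C S T = (\<Sum>m<length cs. lsign (take u cs @ drop (Suc u) cs @ ss) * (-1) ^ (u + m) *
    of_int (a (cs ! m)) * Fvec (take m cs @ drop (Suc m) cs @ ss) T :: 'a)"
    unfolding Lbasis_def Let_def cs_def[symmetric] ss_def[symmetric] the append_assoc
    by (subst if_P) (use assms(5) S in auto)
  also have "\<dots> = (\<Sum>m<length cs. if m = v then lsign (take u cs @ drop (Suc u) cs @ ss) * (-1) ^ (u + v) *
    of_int (a (cs ! v)) * lsign (take v cs @ drop (Suc v) cs @ ss) else 0)"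
    by (intro sum.cong) (auto simp: Fvec)
  finally show ?thesis using assms(6) by simp
qed

lemma Fract_sum: "(\<Sum>x\<in>X. Fract (f x) 1) = Fract (\<Sum>x\<in>X. f x) (1::'b::idom)"
  by (induction X rule: infinite_finite_induct) (simp_all add: Zero_fract_def)

subsection \<open>The Gauss--Manin equations\<close>

text \<open>The prime enters only through its consequences in the field 'f: the circuits are those
  over 'f, each relation stays nonzero there, and e_i + 1 = 0. Multiplying the congruence for A by
  \<kappa> avoids dividing by \<kappa>.\<close>

locale hypergeometric =
  fixes n k :: nat and b :: "nat \<Rightarrow> nat \<Rightarrow> int" and a :: "nat \<Rightarrow> int" and \<kappa> :: int
    and lam :: "nat set \<Rightarrow> nat \<Rightarrow> int" and A :: "nat \<Rightarrow> nat" and q :: "nat \<Rightarrow> int"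
    and e :: "nat \<Rightarrow>\<^sub>0 nat" and I :: "nat set \<Rightarrow> 'f::field mpoly" and Cs :: "nat set set"
  assumes k_pos: "0 < k"
    and Cs_def: "Cs = circuits (of_int :: int \<Rightarrow> 'f) n k b"
    and lam_outside: "\<And>C i. C \<in> Cs \<Longrightarrow> i \<in> {1..n} - C \<Longrightarrow> lam C i = 0"
    and lam_relation: "\<And>C. C \<in> Cs \<Longrightarrow> \<forall>t\<in>{1..k}. (\<Sum>i\<in>{1..n}. lam C i * b t i) = 0"
    and lam_nonzero: "\<And>C. C \<in> Cs \<Longrightarrow> \<exists>i\<in>{1..n}. (of_int (lam C i) :: 'f) \<noteq> 0"
    and A_pos: "\<And>j. j \<in> {1..n} \<Longrightarrow> 0 < A j"
    and A_red: "\<And>j. j \<in> {1..n} \<Longrightarrow> (of_int \<kappa> * of_nat (A j) :: 'f) = of_int (a j)"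
    and e_red: "\<And>i. i \<in> {1..k} \<Longrightarrow> (of_nat (Poly_Mapping.lookup e i + 1) :: 'f) = 0"
    and I_def: "I = (\<lambda>S. if S \<in> indep_sets n k b then Icoef n k b q A e S else 0)"
begin

abbreviation y :: "(nat \<Rightarrow> nat) \<Rightarrow> 'f mpoly" where "y \<equiv> ycoef n k b q e"

definition drop1 :: "nat set \<Rightarrow> nat \<Rightarrow> nat" where
  "drop1 S = (\<lambda>j. A j - (if j \<in> S then 1 else 0))"

abbreviation D :: "nat list \<Rightarrow> 'f" where "D xs \<equiv> of_int (Det k b xs)"

lemma finite_indep_sets: "finite (indep_sets n k b)"
  by (rule finite_subset[of _ "Pow {1..n}"]) (auto simp: indep_sets_def)

lemma circuit:
  assumes "C \<in> Cs"
  shows "C \<subseteq> {1..n}" "finite C" "is_circuit (of_int :: int \<Rightarrow> 'f) k b C"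
  using assms by (auto simp: Cs_def circuits_def intro: finite_subset)

lemma finite_Cs: "finite Cs"
  by (rule finite_subset[of _ "Pow {1..n}"]) (use circuit(1) in auto)

lemma circuit_relation:
  assumes "C \<in> Cs" "t \<in> {1..k}"
  shows "(\<Sum>i\<in>{1..n}. of_int (lam C i) * of_int (b t i)) = (0::'f)"
proof -
  have "(\<Sum>i\<in>{1..n}. of_int (lam C i) * of_int (b t i)) =
      (of_int (\<Sum>i\<in>{1..n}. lam C i * b t i) :: 'f)" by simp
  also have "\<dots> = 0" using lam_relation[OF assms(1)] assms(2) by (simp only: of_int_0)
  finally show ?thesis .
qed

lemma circuit_relation_on:
  assumes "C \<in> Cs" "t \<in> {1..k}" "C \<subseteq> X" "X \<subseteq> {1..n}"
  shows "(\<Sum>i\<in>X. of_int (lam C i) * of_int (b t i)) = (0::'f)"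
proof -
  have "(\<Sum>i\<in>X. of_int (lam C i) * of_int (b t i)) =
      (\<Sum>i\<in>{1..n}. of_int (lam C i) * of_int (b t i) :: 'f)"
  proof (rule sum.mono_neutral_left)
    show "\<forall>i\<in>{1..n} - X. of_int (lam C i) * of_int (b t i) = (0::'f)"
      using assms(3) lam_outside[OF assms(1)] by (metis DiffD1 DiffD2 DiffI mult_zero_left of_int_0 subsetD)
  qed (use assms in auto)
  then show ?thesis using circuit_relation[OF assms(1,2)] by simp
qed

lemma lam_circuit_nonzero:
  assumes "C \<in> Cs" "c \<in> C"
  shows "(of_int (lam C c) :: 'f) \<noteq> 0"
proof (rule circuit_relation_nonzero[OF circuit(3,2)[OF assms(1)] _ _ assms(2)])
  show "\<exists>j\<in>C. (of_int (lam C j) :: 'f) \<noteq> 0"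
    using lam_nonzero[OF assms(1)] lam_outside[OF assms(1)] by (metis DiffI of_int_0)
  show "\<forall>t\<in>{1..k}. (\<Sum>j\<in>C. of_int (lam C j) * of_int (b t j)) = (0::'f)"
    using circuit_relation_on[OF assms(1) _ order_refl circuit(1)[OF assms(1)]] by simp
qed

text \<open>Dependent sets satisfy d_S = 0, so the formula holds for all k-subsets and independence
  need not be tracked further.\<close>

lemma I_eq:
  assumes "S \<subseteq> {1..n}" "card S = k"
  shows "I S = Const (of_int (dval k b S)) * y (drop1 S)"
proof (cases "S \<in> indep_sets n k b")
  case True
  then show ?thesis by (simp add: I_def Icoef_eq_ycoef drop1_def)
next
  case False
  have fin: "finite S" using assms(1) finite_subset by blast
  have "lin_dep (of_int :: int \<Rightarrow> complex) k b S" using False assms by (simp add: indep_sets_def)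
  then have "(of_int (Det k b (sorted_list_of_set S)) :: complex) = 0"
    using assms fin k_pos by (intro Det_lin_dep) auto
  then have "dval k b S = 0" by (simp add: dval_eq_Det)
  then show ?thesis using False by (simp add: I_def)
qed

lemma lsign_I:
  assumes "distinct xs" "set xs \<subseteq> {1..n}" "length xs = k"
  shows "lsign xs * I (set xs) = Const (D xs) * y (drop1 (set xs))"
proof -
  have ls: "(lsign xs :: 'f mpoly) = of_int (lsign xs)" by (simp add: lsign_def)
  have "lsign xs * I (set xs) = (of_int (lsign xs) * of_int (dval k b (set xs))) * y (drop1 (set xs))"
    using assms by (simp add: I_eq distinct_card ls Const_of_int mult.assoc)
  also have "of_int (lsign xs) * of_int (dval k b (set xs)) = Const (D xs)"
    unfolding Det_eq_lsign_dval[OF assms(3,1)] Const_of_int by simp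
  finally show ?thesis .
qed

lemma drop1_insert:
  "j \<notin> T \<Longrightarrow> drop1 (insert j T) = (drop1 T)(j := drop1 T j - 1)"
  by (auto simp: drop1_def fun_eq_iff)

text \<open>Weighting the k total-derivative identities by the cofactors of \<open>us\<close> turns
  the column of \<open>b\<close> at j into a minor. Both the singular vector equations and the
  Gauss--Manin equations are instances, for different \<open>us\<close>.\<close>

lemma sum_Det_ycoef:
  "(\<Sum>j\<in>{1..n}. of_nat (m j) * Const (D (j # us)) * y (m(j := m j - 1))) = 0"
proof -
  have "(\<Sum>j\<in>{1..n}. of_nat (m j) * Const (D (j # us)) * y (m(j := m j - 1))) =
    (\<Sum>j\<in>{1..n}. \<Sum>i\<in>{1..k}. Const (of_int (cofactor k b i us)) *
      (of_nat (m j) * Const (of_int (b i j)) * y (m(j := m j - 1))))"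
    by (simp add: Det_Cons[OF k_pos] Const_sum Const_mult sum_distrib_left sum_distrib_right mult_ac)
  also have "\<dots> = (\<Sum>i\<in>{1..k}. Const (of_int (cofactor k b i us)) *
      (\<Sum>j\<in>{1..n}. of_nat (m j) * Const (of_int (b i j)) * y (m(j := m j - 1))))"
    by (subst sum.swap) (simp only: sum_distrib_left)
  also have "\<dots> = 0"
  proof (rule sum.neutral, rule ballI)
    fix i assume i: "i \<in> {1..k}"
    show "Const (of_int (cofactor k b i us)) *
      (\<Sum>j\<in>{1..n}. of_nat (m j) * Const (of_int (b i j)) * y (m(j := m j - 1))) = 0"
      by (simp only: ycoef_total_derivative[OF e_red[OF i] i] mult_zero_right)
  qed
  finally show ?thesis .
qed

lemma singular: "singular_eqs n k b a I"
  unfolding singular_eqs_def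
proof (intro allI impI, elim conjE)
  fix js assume js: "length js = k - 1" "set js \<subseteq> {1..n}"
  \<comment> \<open>With m = A - 1 on \<open>js\<close>, the exponent m_j equals A_j unless j
    repeats an entry of \<open>js\<close>, and then the minor vanishes. So the weights a_j =
    \<kappa> A_j match.\<close>
  define m where "m = drop1 (set js)"
  have "of_int (a j) * Iext n k b I (j # js) =
    Const (of_int \<kappa>) * (of_nat (m j) * Const (D (j # js)) * y (m(j := m j - 1)))"
    if j: "j \<in> {1..n}" for j
  proof (cases "distinct (j # js)")
    case True
    then have m: "m j = A j" "drop1 (set (j # js)) = m(j := m j - 1)"
      using drop1_insert[of j "set js"] by (simp_all add: m_def drop1_def)
    have "Iext n k b I (j # js) = lsign (j # js) * I (set (j # js))"
      using True by (simp add: Iext_def I_def)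
    also have "\<dots> = Const (D (j # js)) * y (m(j := m j - 1))"
      using lsign_I[OF True] j js k_pos m by simp
    finally have "of_int (a j) * Iext n k b I (j # js) =
        Const (of_int (a j)) * (Const (D (j # js)) * y (m(j := m j - 1)))"
      by (simp add: Const_of_int)
    also have "Const (of_int (a j)) = Const (of_int \<kappa>) * (of_nat (m j) :: 'f mpoly)"
      using A_red[OF j] m by (simp flip: Const_of_nat Const_mult)
    finally show ?thesis by (simp only: mult.assoc)
  next
    case False
    then have "Det k b (j # js) = 0" using js k_pos by (intro Det_not_distinct) auto
    moreover have "Iext n k b I (j # js) = 0" using False by (auto simp: Iext_def)
    ultimately show ?thesis by simp
  qed
  then have "(\<Sum>j\<in>{1..n}. of_int (a j) * Iext n k b I (j # js)) =
    Const (of_int \<kappa>) * (\<Sum>j\<in>{1..n}. of_nat (m j) * Const (D (j # js)) * y (m(j := m j - 1)))"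
    by (simp add: sum_distrib_left)
  then show "(\<Sum>j\<in>{1..n}. of_int (a j) * Iext n k b I (j # js)) = 0"
    by (simp only: sum_Det_ycoef mult_zero_right)
qed

section \<open>The operators L_C applied to I\<close>

lemma Lop_eq_0:
  assumes "C \<in> Cs" "\<not> ((\<exists>c\<in>C. T \<inter> C = C - {c}) \<and> T \<subseteq> {1..n} \<and> card T = k)"
  shows "Lop n k b a C I T = 0"
  unfolding Lop_def
proof (rule sum.neutral, rule ballI)
  fix S assume "S \<in> indep_sets n k b"
  then have S: "S \<subseteq> {1..n}" "card S = k" by (auto simp: indep_sets_def)
  then have fin: "finite S" using finite_subset by blast
  have C: "C \<subseteq> {1..n}" "finite C" using circuit[OF assms(1)] by auto
  have "Lbasis a C S T = (0 :: 'f mpoly)"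
  proof (rule ccontr)
    assume "Lbasis a C S T \<noteq> (0 :: 'f mpoly)"
    then obtain c c' where c: "c \<in> C" "S \<inter> C = C - {c}" "c' \<in> C" "T \<inter> C = C - {c'}" "S - C = T - C"
      using Lbasis_eq_0[OF C(2) _ fin] by metis
    have T: "T = (C - {c'}) \<union> (S - C)" using c by auto
    then have "T \<subseteq> {1..n}" using C S by auto
    moreover have "card T = k"
    proof -
      have "card T = card (C - {c'}) + card (S - C)"
        unfolding T using C fin by (intro card_Un_disjoint) auto
      also have "card (C - {c'}) = card (S \<inter> C)" using c C by simp
      also have "card (S \<inter> C) + card (S - C) = card S"
        using card_Int_Diff[OF fin, of C] by simp
      finally show ?thesis using S by simp
    qed
    ultimately show False using assms(2) c by blast
  qed
  then show "I S * Lbasis a C S T = 0" by simp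
qed

text \<open>In each summand Cramer's rule trades lambda_c times the minor of S for lambda_j times
  the minor of T, where j is the element of C missing from S. Then d_T factors out, and the
  remaining sum over C is the relation \<open>ycoef_relation\<close> at the exponent A - 1 on T with
  c added.\<close>

lemma Lop_circuit:
  assumes C: "C \<in> Cs" and T: "T \<subseteq> {1..n}" "card T = k" and c: "c \<in> C" "T \<inter> C = C - {c}"
  shows "Const (of_int (lam C c)) * Lop n k b a C I T =
    Const (of_int (a c) * of_int (dval k b T)) * (fC n (lam C) * y (drop1 (insert c T)))"
proof -
  define cs where "cs = sorted_list_of_set C"
  define ss where "ss = sorted_list_of_set (T - C)"
  define W where "W m = take m cs @ drop (Suc m) cs @ ss" for m
  \<comment> \<open>The sets from which L_C can reach T.\<close>
  define St where "St m = (C - {cs ! m}) \<union> (T - C)" for m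
  define U where "U = insert c T"
  note C' = circuit(1,2)[OF C]
  have finT: "finite T" using T(1) finite_subset by blast
  have cs: "distinct cs" "set cs = C" "length cs = card C" using C'(2) by (simp_all add: cs_def)
  have ss: "distinct ss" "set ss = T - C" "length ss = card (T - C)" using finT by (simp_all add: ss_def)
  obtain v where v: "v < length cs" "cs ! v = c" using c(1) cs(2) by (metis in_set_conv_nth)
  have mem: "cs ! m \<in> C" if "m < length cs" for m using that cs(2) nth_mem by blast
  have St: "St m \<subseteq> {1..n}" "St m \<inter> C = C - {cs ! m}" "St m - C = T - C" "finite (St m)" for m
    using C' T(1) finT by (auto simp: St_def)
  have len: "length cs + length ss = Suc k"
  proof -
    have "card C > 0" using c(1) C'(2) card_gt_0_iff by blast
    moreover have "card (T \<inter> C) = card C - 1" using c C'(2) by simp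
    moreover have "card (T \<inter> C) + card (T - C) = k" using card_Int_Diff[OF finT, of C] T(2) by simp
    ultimately show ?thesis using cs(3) ss(3) by linarith
  qed
  have W: "distinct (W m)" "set (W m) = St m" "length (W m) = k" if m: "m < length cs" for m
  proof -
    show "set (W m) = St m"
      using set_delete_nth(1)[OF cs(1) m] cs(2) ss(2) by (auto simp: W_def St_def)
    show "distinct (W m)"
      using set_delete_nth[OF cs(1) m] cs(2) ss by (auto simp: W_def)
    show "length (W m) = k" using m len by (simp add: W_def)
  qed
  have Stv: "St v = T" using c(2) v(2) by (auto simp: St_def)
  have inj: "inj_on St {..<length cs}"
  proof (rule inj_onI)
    fix m m' assume m: "m \<in> {..<length cs}" "m' \<in> {..<length cs}" "St m = St m'"
    then have "C - {cs ! m} = C - {cs ! m'}" using St(2) by metis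
    then have "cs ! m = cs ! m'" using mem[of m] mem[of m'] m by auto
    then show "m = m'" using cs(1) m by (simp add: nth_eq_iff_index_eq)
  qed
  have "Lop n k b a C I T = (\<Sum>S\<in>St ` {..<length cs}. I S * Lbasis a C S T)"
    unfolding Lop_def
  \<comment> \<open>Neither index set contains the other: a dependent \<open>St m\<close>
    contributes nothing because I vanishes there, and an independent S not of this form has matrix
    entry 0.\<close>
  proof (rule sum.mono_neutral_cong)
    show "\<And>S. S \<in> St ` {..<length cs} - indep_sets n k b \<Longrightarrow> I S * Lbasis a C S T = 0"
      by (simp add: I_def)
    fix S assume S: "S \<in> indep_sets n k b - St ` {..<length cs}"
    then have fin: "finite S" using finite_subset by (auto simp: indep_sets_def)
    have "Lbasis a C S T = (0 :: 'f mpoly)"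
    proof (rule ccontr)
      assume "Lbasis a C S T \<noteq> (0 :: 'f mpoly)"
      then obtain c1 where c1: "c1 \<in> C" "S \<inter> C = C - {c1}" "S - C = T - C"
        using Lbasis_eq_0[OF C'(2) _ fin] by metis
      obtain m where m: "m < length cs" "cs ! m = c1" using c1(1) cs(2) by (metis in_set_conv_nth)
      have "S = St m" using c1 m(2) by (auto simp: St_def)
      then show False using S m(1) by auto
    qed
    then show "I S * Lbasis a C S T = 0" by simp
  qed (use finite_indep_sets in auto)
  also have "\<dots> = (\<Sum>m<length cs. I (St m) * Lbasis a C (St m) T)"
    by (simp add: sum.reindex[OF inj])
  finally have L: "Lop n k b a C I T = (\<Sum>m<length cs. I (St m) * Lbasis a C (St m) T)" .
  have summand: "Const (of_int (lam C c)) * (I (St m) * Lbasis a C (St m) T) =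
      Const (of_int (a c) * of_int (dval k b T)) *
      (Const (of_int (lam C (cs ! m))) * y ((drop1 U)(cs ! m := drop1 U (cs ! m) + 1)))"
    if m: "m < length cs" for m
  proof -
    \<comment> \<open>\<open>St m\<close> is \<open>U\<close> without \<open>cs ! m\<close>. Adding
      1 undoes the truncated subtraction there because A is positive.\<close>
    have "drop1 (St m) = (drop1 U)(cs ! m := drop1 U (cs ! m) + 1)"
    proof
      fix j
      have "A (cs ! m) > 0" using A_pos C'(1) mem[OF m] by blast
      moreover have "cs ! m \<in> U" using c mem[OF m] by (auto simp: U_def)
      moreover have "j \<in> St m \<longleftrightarrow> j \<in> U \<and> j \<noteq> cs ! m"
        using c mem[OF m] by (auto simp: U_def St_def)
      ultimately show "drop1 (St m) j = ((drop1 U)(cs ! m := drop1 U (cs ! m) + 1)) j"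
        by (auto simp: drop1_def)
    qed
    note y_St = this
    have ls: "lsign xs = (of_int (lsign xs) :: 'f mpoly)" for xs by (simp add: lsign_def)
    have key: "lam C c * (-1) ^ (m + v) * Det k b (W m) = lam C (cs ! m) * Det k b (W v)"
      unfolding W_def v(2)[symmetric]
      by (rule Det_delete_nth[OF k_pos lam_relation[OF C] _ _ cs(1) m v(1) len])
        (use lam_outside[OF C] cs(2) C'(1) in auto)
    have "lsign (W v) * Det k b (W v) = (lsign (W v) * lsign (W v)) * dval k b T"
      using Det_eq_lsign_dval[OF W(3,1)[OF v(1)]] W(2)[OF v(1)] Stv by (simp add: mult.assoc)
    then have Wv: "lsign (W v) * Det k b (W v) = dval k b T" by simp
    have "Lbasis a C (St m) T = (lsign (W m) * (-1) ^ (m + v) * of_int (a c) * lsign (W v) :: 'f mpoly)"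
      using Lbasis_exchange[of C "St m" m v T a] C'(2) St[of m] m v c(2)
      by (simp add: cs_def[symmetric] W_def ss_def)
    then have "I (St m) * Lbasis a C (St m) T =
        (lsign (W m) * I (set (W m))) * ((-1) ^ (m + v) * of_int (a c) * lsign (W v))"
      using W(2)[OF m] by (simp add: mult_ac)
    also have "\<dots> = of_int (Det k b (W m)) * y (drop1 (St m)) *
        ((-1) ^ (m + v) * of_int (a c) * of_int (lsign (W v)))"
      using lsign_I[OF W(1)[OF m]] W[OF m] St(1) by (simp add: Const_of_int ls[of "W v"])
    finally have "Const (of_int (lam C c)) * (I (St m) * Lbasis a C (St m) T) =
        of_int (lam C c * (-1) ^ (m + v) * Det k b (W m)) * of_int (lsign (W v)) * of_int (a c) *
        y (drop1 (St m))"
      by (simp add: Const_of_int mult_ac)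
    also have "of_int (lam C c * (-1) ^ (m + v) * Det k b (W m)) * of_int (lsign (W v)) =
        of_int (lam C (cs ! m)) * (of_int (lsign (W v) * Det k b (W v)) :: 'f mpoly)"
      unfolding key by (simp add: mult_ac)
    finally show ?thesis unfolding Wv y_St by (simp only: Const_of_int Const_mult mult_ac)
  qed
  have "(\<Sum>m<length cs. Const (of_int (lam C (cs ! m))) * y ((drop1 U)(cs ! m := drop1 U (cs ! m) + 1))) =
      (\<Sum>j\<in>C. Const (of_int (lam C j)) * y ((drop1 U)(j := drop1 U j + 1)))"
    by (rule sum.reindex_bij_betw) (use bij_betw_nth[OF cs(1), of "{..<length cs}" C] cs(2) in simp)
  also have "\<dots> = (\<Sum>j\<in>{1..n}. Const (of_int (lam C j)) * y ((drop1 U)(j := drop1 U j + 1)))"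
    using C' lam_outside[OF C] by (intro sum.mono_neutral_left) auto
  also have "\<dots> = fC n (lam C) * y (drop1 U)"
    by (rule ycoef_relation[OF lam_relation[OF C]])
  finally have rel: "(\<Sum>m<length cs. Const (of_int (lam C (cs ! m))) *
      y ((drop1 U)(cs ! m := drop1 U (cs ! m) + 1))) = fC n (lam C) * y (drop1 U)" .
  have "Const (of_int (lam C c)) * Lop n k b a C I T =
      (\<Sum>m<length cs. Const (of_int (lam C c)) * (I (St m) * Lbasis a C (St m) T))"
    unfolding L by (rule sum_distrib_left)
  also have "\<dots> = (\<Sum>m<length cs. Const (of_int (a c) * of_int (dval k b T)) *
      (Const (of_int (lam C (cs ! m))) * y ((drop1 U)(cs ! m := drop1 U (cs ! m) + 1))))"
    by (intro sum.cong refl summand) (simp only: lessThan_iff)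
  finally show ?thesis unfolding sum_distrib_left[symmetric] rel unfolding U_def .
qed

section \<open>Fundamental circuits of a basis and the resulting differential equations\<close>

text \<open>Existence: T with j added has k + 1 elements, hence is dependent, and a circuit inside
  it must contain j. Uniqueness: eliminating j between two such relations gives a relation on the
  independent set T, so they are proportional and have equal support.\<close>

lemma fundamental_circuit:
  assumes T: "T \<subseteq> {1..n}" "card T = k" "(of_int (dval k b T) :: 'f) \<noteq> 0" and j: "j \<in> {1..n} - T"
  shows "\<exists>!C. C \<in> Cs \<and> C - T = {j}"
proof -
  have finT: "finite T" using T(1) finite_subset by blast
  have indep: "\<not> lin_dep (of_int :: int \<Rightarrow> 'f) k b T"
    using Det_lin_dep[OF k_pos, of "sorted_list_of_set T" b, where 'f = 'f] T finT
    by (auto simp: dval_eq_Det)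
  have "lin_dep (of_int :: int \<Rightarrow> 'f) k b (insert j T)"
    unfolding lin_dep_def using j T finT by (intro homogeneous_system_solution) auto
  then obtain C where C: "C \<subseteq> insert j T" "is_circuit (of_int :: int \<Rightarrow> 'f) k b C"
    using lin_dep_contains_circuit[of "insert j T"] finT by blast
  have "lin_dep (of_int :: int \<Rightarrow> 'f) k b C" using C(2) by (simp add: is_circuit_def)
  then have "\<not> C \<subseteq> T" using indep lin_dep_mono[OF _ _ finT] by blast
  then have "C \<in> Cs \<and> C - T = {j}" using C j T(1) by (auto simp: Cs_def circuits_def)
  moreover have "C1 \<subseteq> C2" if C1: "C1 \<in> Cs" "C1 - T = {j}" and C2: "C2 \<in> Cs" "C2 - T = {j}" for C1 C2
  proof
    fix t assume t: "t \<in> C1"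
    define l1 where "l1 s = (of_int (lam C1 s) :: 'f)" for s
    define l2 where "l2 s = (of_int (lam C2 s) :: 'f)" for s
    have sub: "C1 \<subseteq> insert j T" "C2 \<subseteq> insert j T" "insert j T \<subseteq> {1..n}" "j \<in> C1" "j \<in> C2"
      using C1 C2 j T(1) by auto
    have rel: "(\<Sum>s\<in>T. (l2 j * l1 s - l1 j * l2 s) * of_int (b i s)) = 0" if i: "i \<in> {1..k}" for i
    proof -
      have "(\<Sum>s\<in>T. (l2 j * l1 s - l1 j * l2 s) * of_int (b i s)) =
          (\<Sum>s\<in>insert j T. (l2 j * l1 s - l1 j * l2 s) * of_int (b i s))"
        using j finT by simp
      also have "\<dots> = l2 j * (\<Sum>s\<in>insert j T. l1 s * of_int (b i s)) -
          l1 j * (\<Sum>s\<in>insert j T. l2 s * of_int (b i s))"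
        by (simp only: left_diff_distrib sum_subtractf sum_distrib_left mult.assoc)
      also have "\<dots> = 0"
        using circuit_relation_on[OF C1(1) i sub(1,3)] circuit_relation_on[OF C2(1) i sub(2,3)]
        by (simp only: l1_def l2_def mult_zero_right diff_zero)
      finally show ?thesis .
    qed
    have zero: "l2 j * l1 s - l1 j * l2 s = 0" if "s \<in> T" for s
    proof (rule ccontr)
      assume "l2 j * l1 s - l1 j * l2 s \<noteq> 0"
      then have "lin_dep (of_int :: int \<Rightarrow> 'f) k b T"
        unfolding lin_dep_def using rel that
        by (intro exI[of _ "\<lambda>s. l2 j * l1 s - l1 j * l2 s"] conjI bexI[of _ s] ballI)
      then show False using indep by contradiction
    qed
    show "t \<in> C2"
    proof (rule ccontr)
      assume "t \<notin> C2"
      then have "t \<in> T" "l2 t = 0"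
        using t sub lam_outside[OF C2(1), of t] by (auto simp: l2_def)
      moreover have "l1 t \<noteq> 0" "l2 j \<noteq> 0"
        using lam_circuit_nonzero[OF C1(1) t] lam_circuit_nonzero[OF C2(1) sub(5)]
        by (simp_all add: l1_def l2_def)
      ultimately show False using zero[of t] by simp
    qed
  qed
  ultimately show ?thesis by (metis subset_antisym)
qed

text \<open>The quotient of lambda coefficients is, up to sign, the coordinate of g_j at g_i in the
  basis T. For i outside T only the term j = i survives; for i in T the total-derivative identity
  expresses the derivative through the j outside T.\<close>

lemma gauss_manin_polynomial:
  assumes T: "T \<subseteq> {1..n}" "card T = k" "(of_int (dval k b T) :: 'f) \<noteq> 0" and i: "i \<in> {1..n}"
    and circ: "\<And>j. j \<in> {1..n} - T \<Longrightarrow> circ j \<in> Cs \<and> circ j - T = {j}"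
  shows "Const (of_int \<kappa>) * pdz i (I T) = (\<Sum>j\<in>{1..n} - T.
    Const (of_int (lam (circ j) i) / of_int (lam (circ j) j) * of_int (a j) * of_int (dval k b T)) *
    y (drop1 (insert j T)))"
proof -
  define m where "m = drop1 T"
  define d where "d = (of_int (dval k b T) :: 'f)"
  define Z where "Z j = y (m(j := m j - 1))" for j
  define \<rho> where "\<rho> j = (of_int (lam (circ j) i) / of_int (lam (circ j) j) :: 'f)" for j
  have finT: "finite T" using T(1) finite_subset by blast
  have Z: "y (drop1 (insert j T)) = Z j" if "j \<in> {1..n} - T" for j
    using drop1_insert[of j T] that by (simp add: Z_def m_def)
  have mj: "m j = A j" if "j \<in> {1..n} - T" for j
    using that by (simp add: m_def drop1_def)
  have lhs: "Const (of_int \<kappa>) * pdz i (I T) = Const (of_int \<kappa> * d) * (of_nat (m i) * Z i)"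
    unfolding I_eq[OF T(1,2)] pdz_Const_mult pdz_ycoef[OF i] Z_def m_def d_def Const_mult mult.assoc ..
  have lam_j: "(of_int (lam (circ j) j) :: 'f) \<noteq> 0" if "j \<in> {1..n} - T" for j
    using circ[OF that] by (intro lam_circuit_nonzero) auto
  have aj: "of_int (a j) = (of_int \<kappa> * of_nat (A j) :: 'f)" if "j \<in> {1..n} - T" for j
    using A_red[of j] that by simp
  have "Const (of_int \<kappa> * d) * (of_nat (m i) * Z i) =
    (\<Sum>j\<in>{1..n} - T. Const (\<rho> j * of_int (a j) * d) * Z j)"
  proof (cases "i \<in> T")
    case False
    then have i': "i \<in> {1..n} - T" using i by simp
    have "\<rho> j = 0" if "j \<in> {1..n} - T - {i}" for j
    proof -
      have "i \<notin> circ j" using circ[of j] that False by auto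
      then show ?thesis using lam_outside[of "circ j" i] circ[of j] that i by (simp add: \<rho>_def)
    qed
    then have "(\<Sum>j\<in>{1..n} - T. Const (\<rho> j * of_int (a j) * d) * Z j) =
        (\<Sum>j\<in>{i}. Const (\<rho> j * of_int (a j) * d) * Z j)"
      using i' by (intro sum.mono_neutral_right) auto
    also have "\<dots> = Const (of_int (a i) * d) * Z i"
      using lam_j[OF i'] by (simp add: \<rho>_def)
    also have "\<dots> = Const (of_int \<kappa> * d) * (of_nat (m i) * Z i)"
      unfolding aj[OF i'] mj[OF i'] Const_mult Const_of_nat by (simp only: mult_ac)
    finally show ?thesis by simp
  next
    case True
    \<comment> \<open>With the columns of T other than i fixed, \<open>G j\<close> vanishes on T -
      {i}, is d_T up to sign at i, and is minus \<open>\<rho> j\<close> times \<open>G i\<close>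
      outside T by Cramer's rule on \<open>circ j\<close>. Cancelling \<open>G i\<close> then solves
      for the term at i.\<close>
    define us where "us = sorted_list_of_set (T - {i})"
    define G where "G j = D (j # us)" for j
    have us: "distinct us" "set us = T - {i}" "length us = k - 1"
      using finT T(2) True by (simp_all add: us_def)
    have Gi: "G i \<noteq> 0"
    proof -
      have iu: "distinct (i # us)" "length (i # us) = k" "set (i # us) = T"
        using us True k_pos by auto
      have "Det k b (i # us) = lsign (i # us) * dval k b T"
        using Det_eq_lsign_dval[OF iu(2,1)] iu(3) by simp
      then have "lsign (i # us) * Det k b (i # us) = dval k b T"
        by (simp only: mult.assoc[symmetric] lsign_square mult_1)
      then have "of_int (lsign (i # us)) * G i = d"
        unfolding G_def d_def by (metis of_int_mult)
      then show ?thesis using T(3) by (auto simp: d_def)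
    qed
    have G0: "G j = 0" if "j \<in> T - {i}" for j
      using us that k_pos Det_not_distinct[of "j # us" k b] by (auto simp: G_def)
    have Gj: "G j = - (\<rho> j * G i)" if j: "j \<in> {1..n} - T" for j
    proof -
      have "of_int (lam (circ j) j) * of_int (Det k b (j # us)) =
          - (of_int (lam (circ j) i) * (of_int (Det k b (i # us)) :: 'f))"
      proof (rule Det_exchange[where X = "{1..n}", OF k_pos])
        show "\<forall>t\<in>{1..k}. (\<Sum>s\<in>{1..n}. of_int (lam (circ j) s) * of_int (b t s)) = (0::'f)"
          using circuit_relation circ[OF j] by blast
        fix s assume s: "s \<in> {1..n} - {j, i}" "(of_int (lam (circ j) s) :: 'f) \<noteq> 0"
        have "s \<in> circ j"
        proof (rule ccontr)
          assume "s \<notin> circ j"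
          then have "lam (circ j) s = 0" using lam_outside[of "circ j" s] circ[OF j] s(1) by blast
          then show False using s(2) by simp
        qed
        then show "s \<in> set us" using circ[OF j] s us(2) by auto
      qed (use i j True us in auto)
      then show ?thesis using lam_j[OF j] by (simp add: G_def \<rho>_def field_simps)
    qed
    have "0 = (\<Sum>j\<in>{1..n}. of_nat (m j) * Const (G j) * Z j)"
      using sum_Det_ycoef[of m us] by (simp only: G_def Z_def)
    also have "\<dots> = (\<Sum>j\<in>{1..n} - T. of_nat (m j) * Const (G j) * Z j) +
        (\<Sum>j\<in>T. of_nat (m j) * Const (G j) * Z j)"
      using T(1) by (intro sum.subset_diff) auto
    also have "(\<Sum>j\<in>T. of_nat (m j) * Const (G j) * Z j) = (\<Sum>j\<in>{i}. of_nat (m j) * Const (G j) * Z j)"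
      using finT True G0 by (intro sum.mono_neutral_right) auto
    also have "(\<Sum>j\<in>{1..n} - T. of_nat (m j) * Const (G j) * Z j) =
        (\<Sum>j\<in>{1..n} - T. Const (G i) * - (Const (of_nat (A j) * \<rho> j) * Z j))"
    proof (rule sum.cong)
      fix j assume j: "j \<in> {1..n} - T"
      show "of_nat (m j) * Const (G j) * Z j = Const (G i) * - (Const (of_nat (A j) * \<rho> j) * Z j)"
        unfolding Gj[OF j] mj[OF j] by (simp add: Const_uminus Const_mult Const_of_nat mult_ac)
    qed simp
    also have "\<dots> + (\<Sum>j\<in>{i}. of_nat (m j) * Const (G j) * Z j) =
        Const (G i) * (of_nat (m i) * Z i - (\<Sum>j\<in>{1..n} - T. Const (of_nat (A j) * \<rho> j) * Z j))"
      by (simp add: sum_distrib_left sum_negf right_diff_distrib mult_ac)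
    finally have "of_nat (m i) * Z i = (\<Sum>j\<in>{1..n} - T. Const (of_nat (A j) * \<rho> j) * Z j)"
      using Gi by simp
    then have "Const (of_int \<kappa> * d) * (of_nat (m i) * Z i) =
        (\<Sum>j\<in>{1..n} - T. Const (of_int \<kappa> * d) * (Const (of_nat (A j) * \<rho> j) * Z j))"
      by (simp only: sum_distrib_left)
    also have "\<dots> = (\<Sum>j\<in>{1..n} - T. Const (\<rho> j * of_int (a j) * d) * Z j)"
    proof (rule sum.cong)
      fix j assume j: "j \<in> {1..n} - T"
      show "Const (of_int \<kappa> * d) * (Const (of_nat (A j) * \<rho> j) * Z j) =
          Const (\<rho> j * of_int (a j) * d) * Z j"
        unfolding aj[OF j] Const_mult by (simp only: mult_ac)
    qed simp
    finally show ?thesis .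
  qed
  also have "\<dots> = (\<Sum>j\<in>{1..n} - T. Const (\<rho> j * of_int (a j) * d) * y (drop1 (insert j T)))"
    by (intro sum.cong refl) (simp only: Z)
  finally show ?thesis unfolding lhs \<rho>_def d_def .
qed

lemma fC_nonzero:
  assumes "C \<in> Cs"
  shows "fC n (lam C) \<noteq> (0 :: 'f mpoly)"
proof -
  obtain i where i: "i \<in> {1..n}" "(of_int (lam C i) :: 'f) \<noteq> 0" using lam_nonzero[OF assms] by blast
  have single: "Poly_Mapping.single j (1::nat) = Poly_Mapping.single i 1 \<longleftrightarrow> j = i" for j
    by (metis lookup_single_eq lookup_single_not_eq zero_neq_one)
  have "Poly_Mapping.lookup (fC n (lam C) :: 'f mpoly) (Poly_Mapping.single i 1) =
      (\<Sum>j\<in>{1..n}. of_int (lam C j) * (1 when Poly_Mapping.single j (1::nat) = Poly_Mapping.single i 1))"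
    by (simp only: fC_def lookup_sum lookup_Const_mult Var_def lookup_single)
  also have "\<dots> = (\<Sum>j\<in>{1..n}. if j = i then of_int (lam C j) else 0)"
    unfolding single by (intro sum.cong) (auto simp: when_def)
  also have "\<dots> = of_int (lam C i)" using i(1) by simp
  finally show ?thesis using i(2) by auto
qed

text \<open>The factor f_C of L_C I cancels the denominator, so each contribution is a
  polynomial.\<close>

lemma Fract_circuit:
  assumes T: "T \<subseteq> {1..n}" "card T = k" and C: "C \<in> Cs" "C - T = {j}"
  shows "Fract (Const (of_int (lam C i))) (fC n (lam C)) * Fract (Lop n k b a C I T) 1 =
    Fract (Const (of_int (lam C i) / of_int (lam C j) * of_int (a j) * of_int (dval k b T)) *
      y (drop1 (insert j T))) 1"
proof -
  have j: "j \<in> C" "T \<inter> C = C - {j}" using C(2) by auto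
  have nz: "(of_int (lam C j) :: 'f) \<noteq> 0" using lam_circuit_nonzero[OF C(1) j(1)] .
  have "Const (of_int (lam C j)) * (Const (of_int (lam C i)) * Lop n k b a C I T) =
      Const (of_int (lam C i)) * (Const (of_int (lam C j)) * Lop n k b a C I T)"
    by (simp only: mult_ac)
  also have "\<dots> = Const (of_int (lam C i) * (of_int (a j) * of_int (dval k b T))) *
      (fC n (lam C) * y (drop1 (insert j T)))"
    unfolding Lop_circuit[OF C(1) T j] Const_mult by (simp only: mult_ac)
  also have "of_int (lam C i) * (of_int (a j) * of_int (dval k b T)) =
      of_int (lam C j) * (of_int (lam C i) / of_int (lam C j) * of_int (a j) * of_int (dval k b T) :: 'f)"
    using nz by simp
  also have "Const \<dots> * (fC n (lam C) * y (drop1 (insert j T))) = Const (of_int (lam C j)) *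
      (Const (of_int (lam C i) / of_int (lam C j) * of_int (a j) * of_int (dval k b T)) *
        y (drop1 (insert j T)) * fC n (lam C))"
    unfolding Const_mult by (simp only: mult_ac)
  finally have "Const (of_int (lam C i)) * Lop n k b a C I T =
      Const (of_int (lam C i) / of_int (lam C j) * of_int (a j) * of_int (dval k b T)) *
        y (drop1 (insert j T)) * fC n (lam C)"
    using nz by (simp only: mult_cancel_left Const_eq_0_iff) simp
  then show ?thesis using fC_nonzero[OF C(1)] by (simp add: eq_fract)
qed

lemma gauss_manin:
  assumes i: "i \<in> {1..n}"
  shows "Fract (Const (of_int \<kappa>) * pdz i (I T)) 1 = (\<Sum>C\<in>Cs.
    Fract (Const (of_int (lam C i))) (fC n (lam C)) * Fract (Lop n k b a C I T) 1)"
proof (cases "T \<subseteq> {1..n} \<and> card T = k \<and> (of_int (dval k b T) :: 'f) \<noteq> 0")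
  case False
  have "I T = 0"
  proof (cases "T \<subseteq> {1..n} \<and> card T = k")
    case True
    then show ?thesis using False by (simp add: I_eq)
  next
    case False
    then show ?thesis by (auto simp: I_def indep_sets_def)
  qed
  moreover have "Lop n k b a C I T = 0" if C: "C \<in> Cs" for C
  proof (cases "(\<exists>c\<in>C. T \<inter> C = C - {c}) \<and> T \<subseteq> {1..n} \<and> card T = k")
    case True
    then obtain c where c: "c \<in> C" "T \<inter> C = C - {c}" by blast
    have "(of_int (dval k b T) :: 'f) = 0" using True False by blast
    then have "Const (of_int (lam C c)) * Lop n k b a C I T = 0"
      using Lop_circuit[OF C _ _ c] True by simp
    then show ?thesis using lam_circuit_nonzero[OF C c(1)] by simp
  next
    case False
    then show ?thesis by (rule Lop_eq_0[OF C])
  qed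
  ultimately show ?thesis by (simp add: fract_collapse)
next
  case True
  then have T: "T \<subseteq> {1..n}" "card T = k" "(of_int (dval k b T) :: 'f) \<noteq> 0" by auto
  define circ where "circ j = (THE C. C \<in> Cs \<and> C - T = {j})" for j
  have circ: "circ j \<in> Cs \<and> circ j - T = {j}" if "j \<in> {1..n} - T" for j
    unfolding circ_def using fundamental_circuit[OF T that] by (rule theI')
  have inj: "inj_on circ ({1..n} - T)"
    using circ by (intro inj_onI) (metis singleton_inject)
  let ?term = "\<lambda>C. Fract (Const (of_int (lam C i))) (fC n (lam C)) * Fract (Lop n k b a C I T) 1"
  have "(\<Sum>C\<in>Cs. ?term C) = (\<Sum>C\<in>circ ` ({1..n} - T). ?term C)"
  proof (rule sum.mono_neutral_right)
    show "\<forall>C\<in>Cs - circ ` ({1..n} - T). ?term C = 0"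
    proof
      fix C assume C: "C \<in> Cs - circ ` ({1..n} - T)"
      \<comment> \<open>If T misses exactly one element c of C, then C is the fundamental circuit of
        c; every other circuit acts by 0 at T.\<close>
      have "\<not> (\<exists>c\<in>C. T \<inter> C = C - {c})"
      proof
        assume "\<exists>c\<in>C. T \<inter> C = C - {c}"
        then obtain c where c: "c \<in> C" "T \<inter> C = C - {c}" by blast
        then have "C - T = {c}" by auto
        moreover from this have cT: "c \<in> {1..n} - T" using c(1) circuit(1)[of C] C by auto
        ultimately have "C = circ c"
          using fundamental_circuit[OF T cT] circ[OF cT] C by auto
        then show False using C cT by auto
      qed
      then show "?term C = 0" using Lop_eq_0[of C T] C by (simp add: fract_collapse)
    qed
  qed (use finite_Cs circ in auto)
  also have "\<dots> = (\<Sum>j\<in>{1..n} - T. ?term (circ j))"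
    unfolding sum.reindex[OF inj] o_def ..
  also have "\<dots> = (\<Sum>j\<in>{1..n} - T. Fract (Const (of_int (lam (circ j) i) / of_int (lam (circ j) j) *
      of_int (a j) * of_int (dval k b T)) * y (drop1 (insert j T))) 1)"
    using circ by (intro sum.cong refl Fract_circuit T(1,2)) blast+
  also have "\<dots> = Fract (Const (of_int \<kappa>) * pdz i (I T)) 1"
    unfolding Fract_sum by (subst gauss_manin_polynomial[OF T i]) (use circ in auto)
  finally show ?thesis by simp
qed

end

section \<open>Specialization to the field with p elements\<close>

text \<open>Translation by 1 permutes the ring, so the sum of all elements equals itself plus the
  cardinality. This yields p = 0 in a field known only by its number of elements.\<close>

lemma of_nat_card_UNIV_eq_0: "(of_nat (card (UNIV :: 'a::{ring_1,finite} set)) :: 'a) = 0"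
proof -
  have "(\<Sum>x\<in>UNIV. x + 1 :: 'a) = (\<Sum>x\<in>UNIV. x)"
    by (rule sum.reindex_bij_betw[where g = "\<lambda>x. x"]) (rule bij_betwI[where g = "\<lambda>x. x - 1"], auto)
  then show ?thesis by (simp add: sum.distrib)
qed

theorem theorem4p3:
  fixes n k p :: nat and b :: "nat \<Rightarrow> nat \<Rightarrow> int" and a :: "nat \<Rightarrow> int" and \<kappa> :: int
    and lam :: "nat set \<Rightarrow> nat \<Rightarrow> int"
    and A :: "nat \<Rightarrow> nat" and q :: "nat \<Rightarrow> int" and l :: "nat \<Rightarrow> nat"

  assumes k_pos: "0 < k" and k_less: "k < n"
    and g_nonzero: "\<forall>j\<in>{1..n}. \<exists>i\<in>{1..k}. b i j \<noteq> 0"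
    and g_span: "\<forall>w::nat \<Rightarrow> complex. \<exists>c::nat \<Rightarrow> complex.
                   \<forall>i\<in>{1..k}. w i = (\<Sum>j\<in>{1..n}. c j * of_int (b i j))"
    and a_nonzero: "\<forall>j\<in>{1..n}. a j \<noteq> 0"
    and lam_circ: "\<forall>C\<in>circuits (of_int :: int \<Rightarrow> complex) n k b.
          (\<exists>i\<in>{1..n}. lam C i \<noteq> 0) \<and> (\<forall>i\<in>{1..n} - C. lam C i = 0)
          \<and> (\<forall>t\<in>{1..k}. (\<Sum>i\<in>{1..n}. lam C i * b t i) = 0)
          \<and> Gcd (lam C ` {1..n}) = 1"
    and p_prime: "prime p" and F_card: "card (UNIV :: 'f::{field,finite} set) = p"
    and good_g: "\<forall>j\<in>{1..n}. \<exists>i\<in>{1..k}. (of_int (b i j) :: 'f) \<noteq> 0"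
    and good_fC: "\<forall>C\<in>circuits (of_int :: int \<Rightarrow> complex) n k b.
                    \<exists>i\<in>{1..n}. (of_int (lam C i) :: 'f) \<noteq> 0"
    and good_circ: "circuits (of_int :: int \<Rightarrow> 'f) n k b = circuits (of_int :: int \<Rightarrow> complex) n k b"
    and p_kappa: "\<not> int p dvd \<kappa>"
    and A_pos: "\<forall>j\<in>{1..n}. 0 < A j"
    and A_red: "\<forall>j\<in>{1..n}. (of_nat (A j) :: 'f) = of_int (a j) / of_int \<kappa>"
    and l_pos: "\<forall>i\<in>{1..k}. 0 < l i"
  defines "e \<equiv> (\<Sum>i\<in>{1..k}. Poly_Mapping.single i (l i * p - 1))"
  defines "I \<equiv> (\<lambda>S. if S \<in> indep_sets n k b then (Icoef n k b q A e S :: 'f mpoly) else 0)"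
  shows "singular_eqs n k b a I
    \<and> (\<forall>i\<in>{1..n}. \<forall>T.
         Fract (Const (of_int \<kappa>) * pdz i (I T)) 1 =
         (\<Sum>C\<in>circuits (of_int :: int \<Rightarrow> complex) n k b.
             Fract (Const (of_int (lam C i))) (fC n (lam C)) * Fract (Lop n k b a C I T) 1))"
proof -
  let ?Cs = "circuits (of_int :: int \<Rightarrow> complex) n k b"
  have p0: "(of_nat p :: 'f) = 0"
    using of_nat_card_UNIV_eq_0[where 'a = 'f] F_card by simp
  have \<kappa>0: "(of_int \<kappa> :: 'f) \<noteq> 0"
  proof
    assume \<kappa>: "(of_int \<kappa> :: 'f) = 0"
    have "coprime (int p) \<kappa>" using p_prime p_kappa by (simp add: prime_imp_coprime)
    then obtain u v where "u * int p + v * \<kappa> = 1"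
      using bezout_int[of "int p" \<kappa>] by (auto simp: coprime_iff_gcd_eq_1)
    then have "(of_int (u * int p + v * \<kappa>) :: 'f) = 1" by simp
    then show False using p0 \<kappa> by simp
  qed
  interpret hypergeometric n k b a \<kappa> lam A q e I ?Cs
  proof
    show "?Cs = circuits (of_int :: int \<Rightarrow> 'f) n k b" using good_circ by simp
    show "lam C i = 0" if "C \<in> ?Cs" "i \<in> {1..n} - C" for C i using lam_circ that by blast
    show "\<forall>t\<in>{1..k}. (\<Sum>i\<in>{1..n}. lam C i * b t i) = 0" if "C \<in> ?Cs" for C
      using lam_circ that by blast
    show "\<exists>i\<in>{1..n}. (of_int (lam C i) :: 'f) \<noteq> 0" if "C \<in> ?Cs" for C using good_fC that by blast
    show "0 < A j" if "j \<in> {1..n}" for j using A_pos that by blast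
    show "(of_int \<kappa> * of_nat (A j) :: 'f) = of_int (a j)" if "j \<in> {1..n}" for j
      using A_red that \<kappa>0 by simp
    show "(of_nat (Poly_Mapping.lookup e i + 1) :: 'f) = 0" if i: "i \<in> {1..k}" for i
    proof -
      have "Poly_Mapping.lookup e i = l i * p - 1"
        using i by (simp add: e_def lookup_sum lookup_single when_def)
      \<comment> \<open>Positivity makes the subtraction in \<open>l i * p - 1\<close> exact, so the
        exponent plus 1 is a multiple of p.\<close>
      moreover have "l i * p > 0" using l_pos i p_prime by (simp add: prime_gt_0_nat)
      ultimately have "Poly_Mapping.lookup e i + 1 = l i * p" by simp
      then show ?thesis using p0 by (simp only: of_nat_mult mult_zero_right)
    qed
    show "I = (\<lambda>S. if S \<in> indep_sets n k b then Icoef n k b q A e S else 0)"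
      by (simp only: I_def)
  qed (rule k_pos)
  show ?thesis using singular gauss_manin by blast
qed

end
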